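(* Let $U$ be a Galois $\Gamma$-ring in $\mathcal{K}=\mathcal{L}^G$, where $\mathcal{L}=L*\mathcal{M}$. Suppose $\Gamma$ is a Harish-Chandra subalgebra of $U$ and an integrally closed domain. Let $\Lambda$ be the integral closure of $\Gamma$ in $L$. Then $U$ satisfies the Hartwig conditions with this $\Lambda$; that is: $\Lambda$ is a Noetherian integrally closed commutative domain with $L=\operatorname{Frac}\Lambda$; $G$ and $\mathcal{M}$ consist of automorphisms of $L$ obtained by localization from automorphisms of $\Lambda$ (so that $G$ is a subgroup and $\mathcal{M}$ a submonoid of $\operatorname{Aut}_{\mathsf{k}}\Lambda$); and $\Gamma=\Lambda^G$.
   Context: $\mathsf{k}$ is an algebraically closed field of characteristic zero; all rings are $\mathsf{k}$-algebras. Galois rings: let $U$ be an associative algebra, $\Gamma\subset U$ a commutative subalgebra which is a Noetherian domain, with $U$ finitely generated as a $\Gamma$-algebra; $K=\operatorname{Frac}\Gamma$; $L$ a finite Galois extension of $K$ with Galois group $G$; $\mathcal{M}$ a submonoid of $\operatorname{Aut}_{\mathsf{k}}L$ which is separating (if $m,m'\in\mathcal{M}$ have the same restriction to $K$ then $m=m'$) and on which $G$ acts by conjugation, $m^g=gmg^{-1}\in\mathcal{M}$. Let $\mathcal{L}=L*\mathcal{M}$ be the skew monoid ring (free left $L$-module on $\mathcal{M}$ with $m\,l=m(l)\,m$), with $G$ acting by $g(lm)=g(l)m^g$, and $\mathcal{K}=\mathcal{L}^G$. $U$ is a Galois $\Gamma$-ring in $\mathcal{K}$ if $\Gamma\subset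 U\subset\mathcal{K}$ and $UK=KU=\mathcal{K}$. Harish-Chandra subalgebra: $\Gamma\subset U$ such that (i) $\Gamma$ is quasicentral: $\Gamma u\Gamma$ is finitely generated as a left and as a right $\Gamma$-module for every $u\in U$; and (ii) $\Gamma$ is quasicommutative: $\operatorname{Ext}^1_\Gamma(\mathsf{S}_{\mathfrak{m}},\mathsf{S}_{\mathfrak{n}})=0$ for distinct maximal ideals $\mathfrak{m},\mathfrak{n}$ of finite codimension, $\mathsf{S}_{\mathfrak m}$ being the simple $\Gamma/\mathfrak{m}$-module (automatic for commutative $\Gamma$). *)

theory Defs
  imports "HOL-Algebra.Algebra"
begin

section \<open>Fractions, integrality and automorphisms inside a field\<close>

definition frac_field :: "('a, 'b) ring_scheme \<Rightarrow> 'a set \<Rightarrow> 'a set" where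
  "frac_field L A = {a \<otimes>\<^bsub>L\<^esub> inv\<^bsub>L\<^esub> b | a b. a \<in> A \<and> b \<in> A \<and> b \<noteq> \<zero>\<^bsub>L\<^esub>}"

definition integral_over :: "('a, 'b) ring_scheme \<Rightarrow> 'a set \<Rightarrow> 'a \<Rightarrow> bool" where
  "integral_over L A x \<longleftrightarrow>
     (\<exists>p. polynomial\<^bsub>L\<^esub> A p \<and> p \<noteq> [] \<and> lead_coeff p = \<one>\<^bsub>L\<^esub> \<and> ring.eval L p x = \<zero>\<^bsub>L\<^esub>)"

definition integral_closure :: "('a, 'b) ring_scheme \<Rightarrow> 'a set \<Rightarrow> 'a set" where
  "integral_closure L A = {x \<in> carrier L. integral_over L A x}"

definition integrally_closed_domain :: "('a, 'b) ring_scheme \<Rightarrow> 'a set \<Rightarrow> bool" where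
  "integrally_closed_domain L A \<longleftrightarrow>
     domain (L\<lparr>carrier := A\<rparr>) \<and> (\<forall>x \<in> frac_field L A. integral_over L A x \<longrightarrow> x \<in> A)"

text \<open>Automorphisms are taken extensional, as in \<^const>\<open>Bij\<close>, so that equality of automorphisms
  is equality of functions. The set \<open>k\<close> of constants is a subset of the carrier.\<close>

definition alg_auts :: "'a set \<Rightarrow> ('a, 'b) ring_scheme \<Rightarrow> ('a \<Rightarrow> 'a) set" where
  "alg_auts k A = {\<sigma> \<in> ring_iso A A \<inter> extensional (carrier A). \<forall>c \<in> k. \<sigma> c = c}"

definition alg_aut_group :: "'a set \<Rightarrow> ('a, 'b) ring_scheme \<Rightarrow> ('a \<Rightarrow> 'a) monoid" where
  "alg_aut_group k A = (BijGroup (carrier A))\<lparr>carrier := alg_auts k A\<rparr>"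

text \<open>Galois extensions are defined by the fixed field of the automorphism group, as in Bourbaki;
  the Galois group is \<^term>\<open>alg_auts K L\<close>.\<close>

definition finite_galois :: "'a set \<Rightarrow> ('a, 'b) ring_scheme \<Rightarrow> bool" where
  "finite_galois K L \<longleftrightarrow>
     field L \<and> subfield K L \<and> ring.finite_dimension L K (carrier L) \<and>
     {x \<in> carrier L. \<forall>\<sigma> \<in> alg_auts K L. \<sigma> x = x} = K"

text \<open>\<open>conj_by L g m\<close> is \<open>g m g\<inverse>\<close>.\<close>

definition conj_by :: "('a, 'b) ring_scheme \<Rightarrow> ('a \<Rightarrow> 'a) \<Rightarrow> ('a \<Rightarrow> 'a) \<Rightarrow> ('a \<Rightarrow> 'a)" where
  "conj_by L g m = g \<otimes>\<^bsub>BijGroup (carrier L)\<^esub> m \<otimes>\<^bsub>BijGroup (carrier L)\<^esub> inv\<^bsub>BijGroup (carrier L)\<^esub> g"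


section \<open>Skew monoid rings\<close>

text \<open>The element \<open>\<Sum>m. l\<^sub>m m\<close> of \<open>L * M\<close> is represented by the finitely supported function
  \<open>m \<mapsto> l\<^sub>m\<close> on \<open>M\<close>, extended by \<^const>\<open>undefined\<close> outside \<open>M\<close>. The multiplication is the one
  determined by \<open>(a p) (b q) = (a p(b)) (p q)\<close>.\<close>

definition skew_emb :: "('a, 'b) ring_scheme \<Rightarrow> ('a \<Rightarrow> 'a) set \<Rightarrow> 'a \<Rightarrow> (('a \<Rightarrow> 'a) \<Rightarrow> 'a)" where
  "skew_emb L M a = (\<lambda>m \<in> M. if m = \<one>\<^bsub>BijGroup (carrier L)\<^esub> then a else \<zero>\<^bsub>L\<^esub>)"

definition skew_monoid_ring ::
  "('a, 'b) ring_scheme \<Rightarrow> ('a \<Rightarrow> 'a) set \<Rightarrow> (('a \<Rightarrow> 'a) \<Rightarrow> 'a) ring" where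
  "skew_monoid_ring L M =
    \<lparr>carrier = {f \<in> M \<rightarrow>\<^sub>E carrier L. finite {m \<in> M. f m \<noteq> \<zero>\<^bsub>L\<^esub>}},
     monoid.mult = (\<lambda>f h. \<lambda>m \<in> M.
       finsum L (\<lambda>(p, q). f p \<otimes>\<^bsub>L\<^esub> p (h q))
         {(p, q). p \<in> M \<and> q \<in> M \<and> f p \<noteq> \<zero>\<^bsub>L\<^esub> \<and> h q \<noteq> \<zero>\<^bsub>L\<^esub> \<and>
                  p \<otimes>\<^bsub>BijGroup (carrier L)\<^esub> q = m}),
     one = skew_emb L M \<one>\<^bsub>L\<^esub>,
     ring.zero = (\<lambda>m \<in> M. \<zero>\<^bsub>L\<^esub>),
     add = (\<lambda>f h. \<lambda>m \<in> M. f m \<oplus>\<^bsub>L\<^esub> h m)\<rparr>"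

text \<open>The action \<open>g (l m) = g(l) (g m g\<inverse>)\<close>, that is, the coefficient of \<open>m\<close> in \<open>g f\<close> is
  \<open>g\<close> applied to the coefficient of \<open>g\<inverse> m g\<close> in \<open>f\<close>.\<close>

definition skew_act ::
  "('a, 'b) ring_scheme \<Rightarrow> ('a \<Rightarrow> 'a) set \<Rightarrow> ('a \<Rightarrow> 'a) \<Rightarrow> (('a \<Rightarrow> 'a) \<Rightarrow> 'a) \<Rightarrow> (('a \<Rightarrow> 'a) \<Rightarrow> 'a)" where
  "skew_act L M g f = (\<lambda>m \<in> M. g (f (conj_by L (inv\<^bsub>BijGroup (carrier L)\<^esub> g) m)))"

definition skew_invariants ::
  "('a, 'b) ring_scheme \<Rightarrow> ('a \<Rightarrow> 'a) set \<Rightarrow> ('a \<Rightarrow> 'a) set \<Rightarrow> (('a \<Rightarrow> 'a) \<Rightarrow> 'a) set" where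
  "skew_invariants L M G = {f \<in> carrier (skew_monoid_ring L M). \<forall>g \<in> G. skew_act L M g f = f}"


section \<open>Galois rings\<close>

text \<open>All data live in the field \<open>L\<close>: the ground field \<open>k\<close> and the algebra \<open>\<Gamma>\<close> are subsets of
  its carrier, \<open>K = Frac \<Gamma>\<close> is \<^term>\<open>frac_field L \<Gamma>\<close>, and \<open>G = Gal(L/K)\<close> is
  \<^term>\<open>alg_auts (frac_field L \<Gamma>) L\<close>.\<close>

definition galois_setting ::
  "'a set \<Rightarrow> ('a, 'b) ring_scheme \<Rightarrow> 'a set \<Rightarrow> ('a \<Rightarrow> 'a) set \<Rightarrow> bool" where
  "galois_setting k L \<Gamma> M \<longleftrightarrow>
     field L \<and>
     subfield k L \<and> algebraically_closed (L\<lparr>carrier := k\<rparr>) \<and>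
     (\<forall>n::nat. n > 0 \<longrightarrow> [n] \<cdot>\<^bsub>L\<^esub> \<one>\<^bsub>L\<^esub> \<noteq> \<zero>\<^bsub>L\<^esub>) \<and>
     subring \<Gamma> L \<and> k \<subseteq> \<Gamma> \<and> noetherian_domain (L\<lparr>carrier := \<Gamma>\<rparr>) \<and>
     finite_galois (frac_field L \<Gamma>) L \<and>
     submonoid M (alg_aut_group k L) \<and>
     (\<forall>m \<in> M. \<forall>m' \<in> M. (\<forall>x \<in> frac_field L \<Gamma>. m x = m' x) \<longrightarrow> m = m') \<and>
     (\<forall>g \<in> alg_auts (frac_field L \<Gamma>) L. \<forall>m \<in> M. conj_by L g m \<in> M)"

text \<open>\<^const>\<open>ideal_prod\<close> is used for arbitrary subsets \<open>X\<close>, \<open>Y\<close>: \<open>ideal_prod R X Y\<close> is the set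
  of all nonempty finite sums of products \<open>x y\<close>.\<close>

definition galois_ring ::
  "'a set \<Rightarrow> ('a, 'b) ring_scheme \<Rightarrow> 'a set \<Rightarrow> ('a \<Rightarrow> 'a) set \<Rightarrow> (('a \<Rightarrow> 'a) \<Rightarrow> 'a) set \<Rightarrow> bool" where
  "galois_ring k L \<Gamma> M U \<longleftrightarrow>
     galois_setting k L \<Gamma> M \<and>
     (let R = skew_monoid_ring L M; K = frac_field L \<Gamma>; KK = skew_invariants L M (alg_auts K L)
      in subring U R \<and> skew_emb L M ` \<Gamma> \<subseteq> U \<and> U \<subseteq> KK \<and>
         (\<exists>S. finite S \<and> S \<subseteq> U \<and> U = generate_ring R (skew_emb L M ` \<Gamma> \<union> S)) \<and>
         ideal_prod R U (skew_emb L M ` K) = KK \<and>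
         ideal_prod R (skew_emb L M ` K) U = KK)"


section \<open>Harish-Chandra subalgebras\<close>

text \<open>Here \<open>A\<close> is a subset of the carrier of \<open>R\<close>. A finite generating set of the zero module
  can be taken to be \<open>{0}\<close>, so it is harmless that \<^const>\<open>ideal_prod\<close> omits the empty sum.\<close>

definition quasicentral :: "'a set \<Rightarrow> ('a, 'b) ring_scheme \<Rightarrow> bool" where
  "quasicentral A R \<longleftrightarrow>
     (\<forall>u \<in> carrier R. let V = ideal_prod R (ideal_prod R A {u}) A in
        (\<exists>S. finite S \<and> S \<subseteq> V \<and> V = ideal_prod R A S) \<and>
        (\<exists>S. finite S \<and> S \<subseteq> V \<and> V = ideal_prod R S A))"

definition module_homs ::
  "('r, 's) ring_scheme \<Rightarrow> ('r, 'a, 'c) module_scheme \<Rightarrow> ('r, 'b, 'd) module_scheme \<Rightarrow> ('a \<Rightarrow> 'b) set" where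
  "module_homs A V W =
     {f \<in> carrier V \<rightarrow> carrier W.
        (\<forall>x \<in> carrier V. \<forall>y \<in> carrier V. f (x \<oplus>\<^bsub>V\<^esub> y) = f x \<oplus>\<^bsub>W\<^esub> f y) \<and>
        (\<forall>a \<in> carrier A. \<forall>x \<in> carrier V. f (a \<odot>\<^bsub>V\<^esub> x) = a \<odot>\<^bsub>W\<^esub> f x)}"

text \<open>Vanishing of the Yoneda group \<open>Ext\<^sup>1(V, W)\<close>: every extension \<open>0 \<rightarrow> W \<rightarrow> E \<rightarrow> V \<rightarrow> 0\<close> splits.
  As a set, \<open>E\<close> is in bijection with \<open>W \<times> V\<close>, so it suffices to let the elements of \<open>E\<close>
  range over the type of such pairs.\<close>

definition ext1_vanishes ::
  "('r, 's) ring_scheme \<Rightarrow> ('r, 'a, 'c) module_scheme \<Rightarrow> ('r, 'b, 'd) module_scheme \<Rightarrow> bool" where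
  "ext1_vanishes A V W \<longleftrightarrow>
     (\<forall>(E :: ('r, 'b \<times> 'a) module) i p.
        module A E \<and> i \<in> module_homs A W E \<and> p \<in> module_homs A E V \<and>
        inj_on i (carrier W) \<and> p ` carrier E = carrier V \<and>
        i ` carrier W = {e \<in> carrier E. p e = \<zero>\<^bsub>V\<^esub>} \<longrightarrow>
        (\<exists>s \<in> module_homs A V E. \<forall>v \<in> carrier V. p (s v) = v))"

text \<open>For commutative \<open>A\<close> the simple module over the field \<open>A/\<mm>\<close> is \<open>A/\<mm>\<close> itself.\<close>

definition residue_module :: "('a, 'b) ring_scheme \<Rightarrow> 'a set \<Rightarrow> ('a, 'a set) module" where
  "residue_module A m =
     \<lparr>carrier = carrier (A Quot m), monoid.mult = monoid.mult (A Quot m), one = one (A Quot m),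
      ring.zero = ring.zero (A Quot m), add = add (A Quot m),
      smult = (\<lambda>a x. (m +>\<^bsub>A\<^esub> a) \<otimes>\<^bsub>A Quot m\<^esub> x)\<rparr>"

definition finite_codimension :: "'a set \<Rightarrow> ('a, 'b) ring_scheme \<Rightarrow> 'a set \<Rightarrow> bool" where
  "finite_codimension k A m \<longleftrightarrow>
     ring.finite_dimension (A Quot m) ((\<lambda>c. m +>\<^bsub>A\<^esub> c) ` k) (carrier (A Quot m))"

definition quasicommutative :: "'a set \<Rightarrow> ('a, 'b) ring_scheme \<Rightarrow> bool" where
  "quasicommutative k A \<longleftrightarrow>
     (\<forall>m n. maximalideal m A \<and> maximalideal n A \<and> m \<noteq> n \<and>
            finite_codimension k A m \<and> finite_codimension k A n \<longrightarrow>
            ext1_vanishes A (residue_module A m) (residue_module A n))"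

definition harish_chandra_subalgebra :: "'a set \<Rightarrow> 'a set \<Rightarrow> ('a, 'b) ring_scheme \<Rightarrow> bool" where
  "harish_chandra_subalgebra k A R \<longleftrightarrow>
     subring A R \<and> k \<subseteq> A \<and> cring (R\<lparr>carrier := A\<rparr>) \<and>
     quasicentral A R \<and> quasicommutative k (R\<lparr>carrier := A\<rparr>)"


section \<open>Hartwig conditions\<close>

definition is_localization_of ::
  "('a, 'b) ring_scheme \<Rightarrow> 'a set \<Rightarrow> ('a \<Rightarrow> 'a) \<Rightarrow> ('a \<Rightarrow> 'a) \<Rightarrow> bool" where
  "is_localization_of L \<Lambda> \<sigma> \<tau> \<longleftrightarrow>
     (\<forall>a \<in> \<Lambda>. \<forall>b \<in> \<Lambda>. b \<noteq> \<zero>\<^bsub>L\<^esub> \<longrightarrow> \<sigma> (a \<otimes>\<^bsub>L\<^esub> inv\<^bsub>L\<^esub> b) = \<tau> a \<otimes>\<^bsub>L\<^esub> inv\<^bsub>L\<^esub> (\<tau> b))"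

text \<open>The identification of \<open>G\<close> and \<open>M\<close> with a subgroup and a submonoid of \<open>Aut\<^sub>k \<Lambda>\<close> is by
  restriction to \<open>\<Lambda>\<close>, which is required to be an injective homomorphism.\<close>

definition hartwig_conditions ::
  "'a set \<Rightarrow> ('a, 'b) ring_scheme \<Rightarrow> 'a set \<Rightarrow> ('a \<Rightarrow> 'a) set \<Rightarrow> ('a \<Rightarrow> 'a) set \<Rightarrow> 'a set \<Rightarrow> bool" where
  "hartwig_conditions k L \<Gamma> G M \<Lambda> \<longleftrightarrow>
     (let \<Lambda>R = L\<lparr>carrier := \<Lambda>\<rparr>; Aut = alg_aut_group k \<Lambda>R; res = (\<lambda>\<sigma>. restrict \<sigma> \<Lambda>)
      in subring \<Lambda> L \<and> k \<subseteq> \<Lambda> \<and> noetherian_domain \<Lambda>R \<and> integrally_closed_domain L \<Lambda> \<and>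
         frac_field L \<Lambda> = carrier L \<and>
         (\<forall>\<sigma> \<in> G \<union> M. \<exists>\<tau> \<in> alg_auts k \<Lambda>R. is_localization_of L \<Lambda> \<sigma> \<tau>) \<and>
         res \<in> mon ((alg_aut_group k L)\<lparr>carrier := G\<rparr>) Aut \<and> subgroup (res ` G) Aut \<and>
         res \<in> mon ((alg_aut_group k L)\<lparr>carrier := M\<rparr>) Aut \<and> submonoid (res ` M) Aut \<and>
         \<Gamma> = {x \<in> \<Lambda>. \<forall>g \<in> G. g x = x})"

end

theory Submission
  imports Defs
begin

text \<open>Over a Noetherian ring, integrality can be read off from finite generation without
  determinants: if \<open>c\<close> is nonzero and all \<open>c \<otimes> x [^] n\<close> lie in one
  finitely generated module, then \<open>x\<close> is integral, because \<open>c\<close> cancels in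
  a field. The factor \<open>c\<close> is essential, since nothing is known about the coefficient of
  u at m except that it is nonzero. The two sides of \<Gamma> u \<Gamma> behave differently, because
  passing \<gamma> through m twists it. Right generation therefore yields a statement over
  m(\<Gamma>), which the inverse of m carries back to \<Gamma>. Both sides are used because M is
  only a monoid: the inverse of m may lie outside M, so the argument for m cannot simply be repeated
  for it. To pass from m(\<Gamma>) \<subseteq> \<Lambda> to m(\<Lambda>) \<subseteq> \<Lambda>, note
  that m(\<Lambda>) is integral over \<Lambda>; transitivity of integrality then applies because
  \<Lambda> is a finite \<Gamma>-module. A suitable u exists because, if all of U vanished at m, so
  would UK.\<close>

text \<open>Since \<open>\<Gamma>\<close> is Noetherian and integrally closed and the characteristic is zero, the trace form
  embeds \<open>\<Lambda>\<close> into a finite power of \<open>\<Gamma>\<close>, so that \<open>\<Lambda>\<close> is a Noetherian \<open>\<Gamma>\<close>-module. The group \<open>G\<close>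
  preserves \<open>\<Lambda>\<close> because it fixes \<open>\<Gamma>\<close>. For \<open>m \<in> M\<close>, the equality \<open>U K = \<K>\<close> provides an element
  \<open>u \<in> U\<close> whose coefficient \<open>u\<^sub>m\<close> is nonzero. The coefficients at \<open>m\<close> of \<open>u \<gamma>\<^sup>n\<close> and \<open>\<gamma>\<^sup>n u\<close> are
  \<open>u\<^sub>m m(\<gamma>)\<^sup>n\<close> and \<open>\<gamma>\<^sup>n u\<^sub>m\<close>. As \<open>\<Gamma> u \<Gamma>\<close> is finitely generated on the left and on the right, \<open>m(\<gamma>)\<close> is
  integral over \<open>\<Gamma>\<close> and \<open>\<gamma>\<close> is integral over \<open>m(\<Gamma>)\<close>. Hence \<open>m(\<Lambda>) = \<Lambda>\<close>.\<close>

section \<open>Spans over a subring\<close>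

context ring begin

text \<open>Modules are subsets of the ambient ring, so the scalars may be \<Gamma>, its image under
  an automorphism, or K without any change of type. Building a combination term by term gives an
  induction rule in place of indexed sums, and \<open>S\<close> may be infinite.\<close>

inductive_set lspan :: "'a set \<Rightarrow> 'a set \<Rightarrow> 'a set" for A S where
  zero: "\<zero> \<in> lspan A S"
| step: "\<lbrakk>a \<in> A; s \<in> S; y \<in> lspan A S\<rbrakk> \<Longrightarrow> a \<otimes> s \<oplus> y \<in> lspan A S"

text \<open>Over a subring, closure under negation comes from the scalar -1; see
  \<open>submod_uminus\<close>.\<close>

definition submod :: "'a set \<Rightarrow> 'a set \<Rightarrow> bool" where
  "submod A N \<longleftrightarrow> N \<subseteq> carrier R \<and> \<zero> \<in> N \<and> (\<forall>x \<in> N. \<forall>y \<in> N. x \<oplus> y \<in> N) \<and>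
     (\<forall>a \<in> A. \<forall>x \<in> N. a \<otimes> x \<in> N)"

definition fg :: "'a set \<Rightarrow> 'a set \<Rightarrow> bool" where
  "fg A N \<longleftrightarrow> (\<exists>S. finite S \<and> S \<subseteq> N \<and> N = lspan A S)"

text \<open>For a subring \<open>A\<close>, the sets \<open>I\<close> are the ideals of
  \<open>A\<close>, seen inside the larger ring \<open>R\<close>.\<close>

definition noeth :: "'a set \<Rightarrow> bool" where
  "noeth A \<longleftrightarrow> (\<forall>I. submod A I \<and> I \<subseteq> A \<longrightarrow> fg A I)"

lemma submodD:
  assumes "submod A N"
  shows "N \<subseteq> carrier R" "\<zero> \<in> N" "\<And>x y. \<lbrakk>x \<in> N; y \<in> N\<rbrakk> \<Longrightarrow> x \<oplus> y \<in> N"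
    "\<And>a x. \<lbrakk>a \<in> A; x \<in> N\<rbrakk> \<Longrightarrow> a \<otimes> x \<in> N"
  using assms by (auto simp: submod_def)

lemma submod_uminus:
  assumes "subring A R" "submod A N" "x \<in> N"
  shows "\<ominus> x \<in> N"
proof -
  have "(\<ominus> \<one>) \<otimes> x \<in> N"
    using assms subringE(3,5)[OF assms(1)] by (auto intro: submodD)
  moreover have "x \<in> carrier R" using assms(2,3) submodD(1) by blast
  ultimately show ?thesis by (simp add: l_minus)
qed

lemma lspan_mono:
  assumes "A \<subseteq> B" "S \<subseteq> T"
  shows "lspan A S \<subseteq> lspan B T"
proof
  fix x assume "x \<in> lspan A S"
  then show "x \<in> lspan B T"
    by induction (use assms in \<open>auto intro: lspan.intros\<close>)
qed

lemma lspan_least: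
  assumes "submod A N" "S \<subseteq> N"
  shows "lspan A S \<subseteq> N"
proof
  fix x assume "x \<in> lspan A S"
  then show "x \<in> N"
    by induction (use assms in \<open>auto intro!: submodD\<close>)
qed

lemma lspan_carrier:
  assumes "A \<subseteq> carrier R" "S \<subseteq> carrier R"
  shows "lspan A S \<subseteq> carrier R"
  by (rule lspan_least) (use assms in \<open>auto simp: submod_def\<close>)

lemma lspan_add:
  assumes "A \<subseteq> carrier R" "S \<subseteq> carrier R" "x \<in> lspan A S" "y \<in> lspan A S"
  shows "x \<oplus> y \<in> lspan A S"
  using assms(3)
proof induction
  case zero
  then show ?case using assms lspan_carrier[OF assms(1,2)] by auto
next
  case (step a s z)
  have c: "a \<in> carrier R" "s \<in> carrier R" "z \<in> carrier R" "y \<in> carrier R"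
    using step assms lspan_carrier[OF assms(1,2)] by auto
  have "a \<otimes> s \<oplus> z \<oplus> y = a \<otimes> s \<oplus> (z \<oplus> y)" using c by (simp add: a_assoc)
  then show ?case using step by (auto intro: lspan.step)
qed

lemma lspan_smult:
  assumes "subring A R" "S \<subseteq> carrier R" "a \<in> A" "x \<in> lspan A S"
  shows "a \<otimes> x \<in> lspan A S"
  using assms(4)
proof induction
  case zero
  have "a \<in> carrier R" using assms(3) subringE(1)[OF assms(1)] by blast
  then show ?case by (simp add: lspan.zero)
next
  case (step b s z)
  have c: "a \<in> carrier R" "b \<in> carrier R" "s \<in> carrier R" "z \<in> carrier R"
    using step assms lspan_carrier[OF subringE(1)[OF assms(1)] assms(2)] subringE(1)[OF assms(1)] by auto
  have "a \<otimes> (b \<otimes> s \<oplus> z) = (a \<otimes> b) \<otimes> s \<oplus> a \<otimes> z" using c by (simp add: r_distr m_assoc)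
  then show ?case using step assms(3) subringE(6)[OF assms(1)] by (auto intro: lspan.step)
qed

lemma submod_lspan:
  assumes "subring A R" "S \<subseteq> carrier R"
  shows "submod A (lspan A S)"
  using lspan_carrier[OF subringE(1)[OF assms(1)] assms(2)]
    lspan_add[OF subringE(1)[OF assms(1)] assms(2)] lspan_smult[OF assms]
  by (auto simp: submod_def intro: lspan.zero)

lemma lspan_incl:
  assumes "subring A R" "S \<subseteq> carrier R"
  shows "S \<subseteq> lspan A S"
proof
  fix s assume "s \<in> S"
  then have "\<one> \<otimes> s \<oplus> \<zero> \<in> lspan A S"
    using subringE(3)[OF assms(1)] by (auto intro: lspan.intros)
  then show "s \<in> lspan A S" using \<open>s \<in> S\<close> assms(2) by auto
qed

lemma lspan_insertE:
  assumes "subring A R" "insert s S \<subseteq> carrier R" "y \<in> lspan A (insert s S)"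
  obtains a z where "a \<in> A" "z \<in> lspan A S" "y = a \<otimes> s \<oplus> z"
proof -
  note A = subringE[OF assms(1)]
  have "\<exists>a\<in>A. \<exists>z\<in>lspan A S. y = a \<otimes> s \<oplus> z"
    using assms(3)
  proof induction
    case zero
    show ?case
      by (rule bexI[OF _ A(2)], rule bexI[OF _ lspan.zero]) (use assms in auto)
  next
    case (step b t y)
    then obtain a z where az: "a \<in> A" "z \<in> lspan A S" "y = a \<otimes> s \<oplus> z" by auto
    have c: "a \<in> carrier R" "b \<in> carrier R" "s \<in> carrier R" "t \<in> carrier R" "z \<in> carrier R"
      using az step assms A(1) lspan_carrier[OF A(1), of S] by auto
    show ?case
    proof (cases "t = s")
      case True
      then have "b \<otimes> t \<oplus> y = (b \<oplus> a) \<otimes> s \<oplus> z"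
        using az c by (simp add: l_distr a_assoc)
      then show ?thesis using az step A(7) by blast
    next
      case False
      then have "b \<otimes> t \<oplus> z \<in> lspan A S" using step az by (auto intro: lspan.step)
      moreover have "b \<otimes> t \<oplus> y = a \<otimes> s \<oplus> (b \<otimes> t \<oplus> z)" using az c by (simp add: a_lcomm)
      ultimately show ?thesis using az by blast
    qed
  qed
  then show thesis using that by blast
qed

lemma lspan_insert_subset:
  assumes "a \<in> A" "z \<in> lspan A S"
  shows "a \<otimes> s \<oplus> z \<in> lspan A (insert s S)"
  using assms lspan_mono[of A A S "insert s S"] by (auto intro: lspan.step)

lemma lspan_hom:
  assumes "h \<in> ring_hom R R" "A \<subseteq> carrier R" "S \<subseteq> carrier R" "x \<in> lspan A S"
  shows "h x \<in> lspan (h ` A) (h ` S)"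
  using assms(4)
proof induction
  case zero
  then show ?case using ring_hom_zero[OF assms(1) ring_axioms ring_axioms] by (auto intro: lspan.zero)
next
  case (step a s y)
  have "a \<in> carrier R" "s \<in> carrier R" "y \<in> carrier R"
    using step assms lspan_carrier[OF assms(2,3)] by auto
  then have "h (a \<otimes> s \<oplus> y) = h a \<otimes> h s \<oplus> h y"
    using ring_hom_add[OF assms(1)] ring_hom_mult[OF assms(1)] by simp
  then show ?case using step by (auto intro: lspan.step)
qed

text \<open>The relation \<open>P\<close> plays the role of a linear map \<open>N \<rightarrow> A\<close>, with \<open>{x \<in> N. P x \<zero>}\<close> as its
  kernel. A relation is needed since the coefficient of a generator is not a function on a span.\<close>

lemma fg_extension:
  assumes "noeth A" "subring A R" "submod A N"
    and tot: "\<And>x. x \<in> N \<Longrightarrow> \<exists>a\<in>A. P x a"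
    and P0: "P \<zero> \<zero>"
    and Padd: "\<And>x y a b. \<lbrakk>x \<in> N; y \<in> N; a \<in> A; b \<in> A; P x a; P y b\<rbrakk> \<Longrightarrow> P (x \<oplus> y) (a \<oplus> b)"
    and Pmult: "\<And>x a c. \<lbrakk>x \<in> N; a \<in> A; c \<in> A; P x a\<rbrakk> \<Longrightarrow> P (c \<otimes> x) (c \<otimes> a)"
    and fgN: "fg A {x \<in> N. P x \<zero>}"
  shows "fg A N"
proof -
  note A = subringE[OF assms(2)] and N = submodD[OF assms(3)]
  \<comment> \<open>\<open>I\<close> is the image of the relation, an ideal of \<open>A\<close>.
    Generators of \<open>I\<close> lifted to \<open>N\<close>, together with generators of the
    kernel, will generate \<open>N\<close>.\<close>
  define I where "I = {a \<in> A. \<exists>x\<in>N. P x a}"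
  have "submod A I"
  proof -
    have "a \<oplus> b \<in> I" if "a \<in> I" "b \<in> I" for a b
      using that Padd N(3) A(7) unfolding I_def by blast
    moreover have "c \<otimes> a \<in> I" if "a \<in> I" "c \<in> A" for a c
      using that Pmult N(4) A(6) unfolding I_def by blast
    ultimately show ?thesis
      using A(1,2) N(2) P0 unfolding submod_def I_def by blast
  qed
  then obtain T where T: "finite T" "T \<subseteq> I" "I = lspan A T"
    using assms(1) by (auto simp: noeth_def fg_def I_def)
  have "\<forall>t\<in>T. \<exists>x. x \<in> N \<and> P x t" using T by (auto simp: I_def)
  then obtain w where w: "\<And>t. t \<in> T \<Longrightarrow> w t \<in> N \<and> P (w t) t" by metis
  obtain S where S: "finite S" "S \<subseteq> {x \<in> N. P x \<zero>}" "{x \<in> N. P x \<zero>} = lspan A S"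
    using fgN by (auto simp: fg_def)
  define V where "V = S \<union> w ` T"
  have VN: "V \<subseteq> N" using S w by (auto simp: V_def)
  have sV: "submod A (lspan A V)" by (rule submod_lspan) (use assms VN N in auto)
  have wT: "lspan A (w ` T) \<subseteq> N" by (rule lspan_least) (use w assms(3) in auto)
  \<comment> \<open>\<open>P\<close> respects only sums and multiples, so a preimage of a
    combination of \<open>T\<close> is assembled term by term from the chosen preimages
    \<open>w t\<close>.\<close>
  have lift: "\<exists>y\<in>lspan A (w ` T). P y a" if "a \<in> lspan A T" for a
    using that
  proof induction
    case zero
    then show ?case using P0 by (auto intro: lspan.zero)
  next
    case (step a t b)
    then obtain y where y: "y \<in> lspan A (w ` T)" "P y b" by auto
    have "b \<in> A" "t \<in> A" using step T by (auto simp: I_def)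
    then have "P (a \<otimes> w t \<oplus> y) (a \<otimes> t \<oplus> b)"
      using step y w wT N A by (auto intro!: Padd Pmult)
    moreover have "a \<otimes> w t \<oplus> y \<in> lspan A (w ` T)"
      using step y by (auto intro: lspan.step)
    ultimately show ?case by auto
  qed
  have "N \<subseteq> lspan A V"
  proof
    fix x assume x: "x \<in> N"
    then obtain a where a: "a \<in> A" "P x a" using tot by auto
    then have "a \<in> lspan A T" using x T by (auto simp: I_def)
    then obtain y where y: "y \<in> lspan A (w ` T)" "P y a" using lift by auto
    have yN: "y \<in> N" using y wT by auto
    have c: "x \<in> carrier R" "y \<in> carrier R" "a \<in> carrier R" using x yN N a A by auto
    \<comment> \<open>\<open>x\<close> and \<open>y\<close> share the value \<open>a\<close>, so
      their difference is in the kernel. It is written with the scalar -1 so that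
      \<open>Padd\<close> and \<open>Pmult\<close> apply.\<close>
    let ?z = "x \<oplus> (\<ominus> \<one>) \<otimes> y"
    have "P ?z (a \<oplus> (\<ominus> \<one>) \<otimes> a)"
      using x yN a y A(3,5,6) N(4) by (intro Padd Pmult) auto
    moreover have "a \<oplus> (\<ominus> \<one>) \<otimes> a = \<zero>" using c by (simp add: l_minus r_neg)
    moreover have "?z \<in> N" using x yN A(3,5) N(3,4) by blast
    ultimately have "?z \<in> {x \<in> N. P x \<zero>}" by simp
    then have "?z \<in> lspan A V"
      using S(3) lspan_mono[of A A S V] by (auto simp: V_def)
    moreover have "y \<in> lspan A V" using y lspan_mono[of A A "w ` T" V] by (auto simp: V_def)
    ultimately have "?z \<oplus> y \<in> lspan A V" using submodD(3)[OF sV] by blast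
    moreover have "?z \<oplus> y = x" using c by (simp add: l_minus a_assoc l_neg)
    ultimately show "x \<in> lspan A V" by simp
  qed
  moreover have "lspan A V \<subseteq> N" using lspan_least[OF assms(3) VN] .
  moreover have "finite V" using T S by (simp add: V_def)
  ultimately show ?thesis using VN unfolding fg_def by blast
qed

text \<open>Induction on the number of generators: reading off a coefficient at \<open>s\<close>
  maps \<open>N\<close> to \<open>A\<close>, and the kernel \<open>N \<inter> lspan A S\<close>
  falls under the induction hypothesis.\<close>

lemma fg_submod_of_lspan:
  assumes "noeth A" "subring A R" "finite S" "S \<subseteq> carrier R" "submod A N" "N \<subseteq> lspan A S"
  shows "fg A N"
  using assms(3-6)
proof (induction S arbitrary: N rule: finite_induct)
  case empty
  have "x = \<zero>" if "x \<in> lspan A {}" for x using that by cases auto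
  then have "N = lspan A {}" using empty submodD(2) by (auto intro: lspan.zero)
  then show ?case unfolding fg_def by blast
next
  case (insert s S)
  note A = subringE[OF assms(2)] and N = submodD[OF insert(5)]
  have S: "s \<in> carrier R" "S \<subseteq> carrier R" using insert by auto
  note B = submodD[OF submod_lspan[OF assms(2) S(2)]]
  define P where "P x a \<longleftrightarrow> (\<exists>y\<in>lspan A S. x = a \<otimes> s \<oplus> y)" for x a
  show ?case
  proof (rule fg_extension[OF assms(1,2) insert(5), of P])
    show "\<exists>a\<in>A. P x a" if "x \<in> N" for x
      using lspan_insertE[OF assms(2), of s S x] that insert(6) S unfolding P_def by blast
    show "P \<zero> \<zero>" unfolding P_def by (rule bexI[OF _ lspan.zero]) (use S in auto)
    show "P (x \<oplus> y) (a \<oplus> b)" if h: "a \<in> A" "b \<in> A" "P x a" "P y b" for x y a b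
    proof -
      obtain u v where uv: "u \<in> lspan A S" "x = a \<otimes> s \<oplus> u" "v \<in> lspan A S" "y = b \<otimes> s \<oplus> v"
        using h by (auto simp: P_def)
      have c: "a \<in> carrier R" "b \<in> carrier R" "u \<in> carrier R" "v \<in> carrier R"
        using h uv A(1) B(1) by blast+
      have "x \<oplus> y = (a \<oplus> b) \<otimes> s \<oplus> (u \<oplus> v)"
        using uv c S by (simp add: l_distr a_ac)
      then show ?thesis using uv B unfolding P_def by blast
    qed
    show "P (c \<otimes> x) (c \<otimes> a)" if h: "a \<in> A" "c \<in> A" "P x a" for x a c
    proof -
      obtain u where uv: "u \<in> lspan A S" "x = a \<otimes> s \<oplus> u"
        using h by (auto simp: P_def)
      have c: "a \<in> carrier R" "c \<in> carrier R" "u \<in> carrier R"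
        using h uv A(1) B(1) by blast+
      have "c \<otimes> x = (c \<otimes> a) \<otimes> s \<oplus> c \<otimes> u"
        using uv c S by (simp add: r_distr m_assoc)
      then show ?thesis using uv B h unfolding P_def by blast
    qed
    have "{x \<in> N. P x \<zero>} = N \<inter> lspan A S"
      using S B(1) by (auto simp: P_def subset_eq)
    moreover have "fg A (N \<inter> lspan A S)"
      by (rule insert.IH) (use S N B in \<open>auto simp: submod_def\<close>)
    ultimately show "fg A {x \<in> N. P x \<zero>}" by simp
  qed
qed

text \<open>Functionals with trivial common kernel embed \<open>N\<close> into a finite power of
  \<open>A\<close>. Passing to the kernel of one functional at a time avoids forming that
  power.\<close>

lemma fg_functionals:
  assumes "noeth A" "subring A R" "finite F" "submod A N"
    and "\<And>f x. \<lbrakk>f \<in> F; x \<in> N\<rbrakk> \<Longrightarrow> f x \<in> A"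
    and "\<And>f x y. \<lbrakk>f \<in> F; x \<in> N; y \<in> N\<rbrakk> \<Longrightarrow> f (x \<oplus> y) = f x \<oplus> f y"
    and "\<And>f a x. \<lbrakk>f \<in> F; a \<in> A; x \<in> N\<rbrakk> \<Longrightarrow> f (a \<otimes> x) = a \<otimes> f x"
    and "\<And>x. \<lbrakk>x \<in> N; \<forall>f\<in>F. f x = \<zero>\<rbrakk> \<Longrightarrow> x = \<zero>"
  shows "fg A N"
  using assms(3-)
proof (induction F arbitrary: N rule: finite_induct)
  case empty
  have "x = \<zero>" if "x \<in> lspan A {}" for x using that by cases auto
  then have "N = lspan A {}" using empty submodD(2) by (auto intro: lspan.zero)
  then show ?case unfolding fg_def by blast
next
  case (insert f F)
  note A = subringE[OF assms(2)] and N = submodD[OF insert(4)]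
  have f0: "g \<zero> = \<zero>" if "g \<in> insert f F" for g
  proof -
    have "g \<zero> = g (\<zero> \<otimes> \<zero>)" by simp
    also have "\<dots> = \<zero> \<otimes> g \<zero>" using that A N by (intro insert.prems(4)) auto
    also have "\<dots> = \<zero>" using insert.prems(2)[OF that N(2)] A(1) by auto
    finally show ?thesis .
  qed
  show ?case
  proof (rule fg_extension[OF assms(1,2) insert(4), of "\<lambda>x a. f x = a"])
    show "fg A {x \<in> N. f x = \<zero>}"
    proof (rule insert.IH)
      have "f (x \<oplus> y) = \<zero>" if "x \<in> N" "y \<in> N" "f x = \<zero>" "f y = \<zero>" for x y
        using insert.prems(3)[of f x y] that by simp
      moreover have "f (a \<otimes> x) = \<zero>" if "a \<in> A" "x \<in> N" "f x = \<zero>" for a x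
        using insert.prems(4)[of f a x] that A(1) by auto
      ultimately show "submod A {x \<in> N. f x = \<zero>}"
        using N f0 unfolding submod_def by blast
      show "x = \<zero>" if "x \<in> {x \<in> N. f x = \<zero>}" "\<forall>f\<in>F. f x = \<zero>" for x
        using that insert.prems(5)[of x] by blast
    qed (use insert.prems(2-4) in blast)+
    show "\<exists>a\<in>A. f x = a" if "x \<in> N" for x using insert.prems(2)[of f x] that by blast
    show "f \<zero> = \<zero>" using f0 by blast
    show "f (x \<oplus> y) = a \<oplus> b" if "x \<in> N" "y \<in> N" "f x = a" "f y = b" for x y a b
      using insert.prems(3)[of f x y] that by simp
    show "f (c \<otimes> x) = c \<otimes> a" if "x \<in> N" "c \<in> A" "f x = a" for x a c
      using insert.prems(4)[of f c x] that by simp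
  qed
qed

end

section \<open>Integral elements\<close>

context ring begin

text \<open>Products of the two generating sets generate the tower; this is the counting behind
  transitivity of integrality.\<close>

lemma lspan_tower:
  assumes "subring A R" "S \<subseteq> carrier R" "T \<subseteq> carrier R" "B \<subseteq> lspan A T" "x \<in> lspan B S"
  shows "x \<in> lspan A ((\<lambda>(t, s). t \<otimes> s) ` (T \<times> S))"
proof -
  let ?V = "(\<lambda>(t, s). t \<otimes> s) ` (T \<times> S)"
  have V: "?V \<subseteq> carrier R" using assms by auto
  note N = submodD[OF submod_lspan[OF assms(1) V]]
  note A = subringE[OF assms(1)]
  have "b \<otimes> s \<in> lspan A ?V" if "b \<in> lspan A T" "s \<in> S" for b s
    using that(1)
  proof induction
    case zero
    then show ?case using that assms N by auto
  next
    case (step a t y)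
    have c: "a \<in> carrier R" "t \<in> carrier R" "s \<in> carrier R" "y \<in> carrier R"
      using step that assms A(1) lspan_carrier[OF A(1) assms(3)] by blast+
    have "(a \<otimes> t \<oplus> y) \<otimes> s = a \<otimes> (t \<otimes> s) \<oplus> y \<otimes> s"
      using c by (simp add: l_distr m_assoc)
    moreover have "t \<otimes> s \<in> ?V" using step that by auto
    ultimately show ?case using step lspan.step[of a A "t \<otimes> s" ?V] by simp
  qed
  with assms(5) show ?thesis
  proof induction
    case (step b s y)
    then show ?case using N(3) assms(4) by blast
  qed (simp add: lspan.zero)
qed

end

section \<open>Noetherian subrings, and spans of products and powers\<close>

context cring begin

text \<open>Bridge from ideals of the record with carrier \<open>A\<close> to spans inside
  \<open>R\<close>: by minimality, the ideal generated by \<open>T\<close> is contained in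
  \<open>lspan A T\<close>.\<close>

lemma noeth_of_noetherian_ring:
  assumes "subring A R" "noetherian_ring (R\<lparr>carrier := A\<rparr>)"
  shows "noeth A"
  unfolding noeth_def
proof (intro allI impI)
  interpret S: noetherian_ring "R\<lparr>carrier := A\<rparr>" by fact
  note A = subringE[OF assms(1)]
  have ideal: "ideal I (R\<lparr>carrier := A\<rparr>)" if I: "submod A I" "I \<subseteq> A" for I
  proof (rule idealI[OF S.ring_axioms])
    have "subgroup I (add_monoid R)"
      using I submodD[OF I(1)] submod_uminus[OF assms(1) I(1)]
      by (intro add.subgroupI) (auto simp: a_inv_def[symmetric])
    then show "subgroup I (add_monoid (R\<lparr>carrier := A\<rparr>))"
      using add.subgroup_incl[OF _ subring.axioms(1)[OF assms(1)] I(2)] by simp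
    show "x \<otimes>\<^bsub>R\<lparr>carrier := A\<rparr>\<^esub> a \<in> I" "a \<otimes>\<^bsub>R\<lparr>carrier := A\<rparr>\<^esub> x \<in> I"
      if "a \<in> I" "x \<in> carrier (R\<lparr>carrier := A\<rparr>)" for a x
    proof -
      have "a \<in> carrier R" "x \<in> carrier R" using that A(1) I(2) by auto
      then have "a \<otimes> x = x \<otimes> a" by (rule m_comm)
      then show "x \<otimes>\<^bsub>R\<lparr>carrier := A\<rparr>\<^esub> a \<in> I" "a \<otimes>\<^bsub>R\<lparr>carrier := A\<rparr>\<^esub> x \<in> I"
        using that submodD(4)[OF I(1), of x a] by auto
    qed
  qed
  fix I assume "submod A I \<and> I \<subseteq> A"
  then have sI: "submod A I" and IA: "I \<subseteq> A" by auto
  obtain T where T: "T \<subseteq> A" "finite T" "I = Idl\<^bsub>R\<lparr>carrier := A\<rparr>\<^esub> T"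
    using S.finetely_gen[OF ideal[OF sI IA]] by auto
  have TI: "T \<subseteq> I" using S.genideal_self[of T] T by simp
  have Tc: "T \<subseteq> carrier R" using T(1) A(1) by auto
  have sA: "submod A A" using A by (simp add: submod_def)
  have "I \<subseteq> lspan A T"
    unfolding T(3)
  proof (rule S.genideal_minimal)
    show "ideal (lspan A T) (R\<lparr>carrier := A\<rparr>)"
      by (rule ideal[OF submod_lspan[OF assms(1) Tc] lspan_least[OF sA T(1)]])
    show "T \<subseteq> lspan A T" by (rule lspan_incl[OF assms(1) Tc])
  qed
  then have "I = lspan A T" using lspan_least[OF sI TI] by blast
  then show "fg A I" using T(2) TI unfolding fg_def by blast
qed

lemma lspan_mult_stable:
  assumes "A \<subseteq> carrier R" "S \<subseteq> carrier R" "c \<in> carrier R" "submod A N"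
    and "\<And>s. s \<in> S \<Longrightarrow> c \<otimes> s \<in> N" "y \<in> lspan A S"
  shows "c \<otimes> y \<in> N"
  using assms(6)
proof induction
  case zero
  then show ?case using assms(3) submodD(2)[OF assms(4)] by simp
next
  case (step a s y)
  have c: "a \<in> carrier R" "s \<in> carrier R" "y \<in> carrier R"
    using step assms lspan_carrier[OF assms(1,2)] by auto
  have "c \<otimes> (a \<otimes> s \<oplus> y) = a \<otimes> (c \<otimes> s) \<oplus> c \<otimes> y"
    using c assms(3) by (simp add: r_distr m_lcomm)
  then show ?case using step assms submodD(3,4)[OF assms(4)] by simp
qed

lemma lspan_mult:
  assumes "subring A R" "S \<subseteq> carrier R" "T \<subseteq> carrier R" "x \<in> lspan A S" "y \<in> lspan A T"
  shows "x \<otimes> y \<in> lspan A ((\<lambda>(s, t). s \<otimes> t) ` (S \<times> T))"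
proof -
  let ?V = "(\<lambda>(s, t). s \<otimes> t) ` (S \<times> T)"
  have V: "?V \<subseteq> carrier R" using assms by auto
  note A = subringE[OF assms(1)]
  note N = submod_lspan[OF assms(1) V]
  have x: "x \<in> carrier R" and y: "y \<in> carrier R"
    using assms lspan_carrier A(1) by blast+
  have "y \<otimes> s \<in> lspan A ?V" if "s \<in> S" for s
  proof -
    have "s \<otimes> y \<in> lspan A ?V"
      by (rule lspan_mult_stable[OF A(1) assms(3) _ N _ assms(5)])
        (use that assms lspan_incl[OF assms(1) V] in auto)
    then show ?thesis using that y assms(2) by (subst m_comm) auto
  qed
  then have "y \<otimes> x \<in> lspan A ?V"
    by (intro lspan_mult_stable[OF A(1) assms(2) y N _ assms(4)]) auto
  then show ?thesis using x y by (simp add: m_comm)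
qed

text \<open>The assumption makes the span of the lower powers stable under multiplication by
  \<open>x\<close>; it contains 1, hence every power.\<close>

lemma lspan_powers:
  assumes "subring A R" "x \<in> carrier R" "x [^] n \<in> lspan A ((\<lambda>i. x [^] i) ` {..<n::nat})"
  shows "x [^] (j::nat) \<in> lspan A ((\<lambda>i. x [^] i) ` {..<n})"
proof -
  let ?S = "(\<lambda>i. x [^] i) ` {..<n::nat}"
  have S: "?S \<subseteq> carrier R" using assms by auto
  have st: "x \<otimes> x [^] i \<in> lspan A ?S" if "i < n" for i
  proof (cases "Suc i = n")
    case True
    then have "x [^] n = x [^] i \<otimes> x" by auto
    then show ?thesis using assms by (simp add: m_comm)
  next
    case False
    then have "x [^] Suc i \<in> lspan A ?S" using that lspan_incl[OF assms(1) S] by fastforce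
    then show ?thesis using assms by (simp add: m_comm)
  qed
  have st': "x \<otimes> y \<in> lspan A ?S" if "y \<in> lspan A ?S" for y
    by (rule lspan_mult_stable[OF subringE(1)[OF assms(1)] S assms(2) submod_lspan[OF assms(1) S] _ that])
      (use st in auto)
  show ?thesis
  proof (cases "n = 0")
    case True
    \<comment> \<open>For \<open>n = 0\<close> the assumption reads 1 = 0, and the ring is
      trivial.\<close>
    have "\<one> \<in> lspan A {}" using assms(3) True by simp
    moreover have "y = \<zero>" if "y \<in> lspan A {}" for y using that by cases auto
    ultimately have "\<one> = \<zero>" by blast
    then have "x [^] j = \<zero>" using assms(2) by (metis l_one nat_pow_closed l_null)
    then show ?thesis by (simp add: lspan.zero)
  next
    case False
    then show ?thesis
    proof (induction j)
      case 0
      then show ?case using lspan_incl[OF assms(1) S] by force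
    next
      case (Suc j)
      then show ?case using st' assms(2) by (simp add: m_comm)
    qed
  qed
qed

end

section \<open>Integrality over a Noetherian subring\<close>

context domain begin

text \<open>A monic equation of degree \<open>n\<close> says precisely that the \<open>n\<close>-th
  power is a combination of lower ones. Later arguments use this form and leave coefficient lists
  behind.\<close>

lemma integral_over_iff:
  assumes "subring A R" "x \<in> carrier R"
  shows "integral_over R A x \<longleftrightarrow> (\<exists>n::nat. x [^] n \<in> lspan A ((\<lambda>i. x [^] i) ` {..<n}))"
proof
  note A = subringE[OF assms(1)]
  have S: "(\<lambda>i::nat. x [^] i) ` {..<n} \<subseteq> carrier R" for n using assms by auto
  {
    assume "integral_over R A x"
    then obtain p where p: "polynomial\<^bsub>R\<^esub> A p" "p \<noteq> []" "lead_coeff p = \<one>" "eval p x = \<zero>"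
      by (auto simp: integral_over_def)
    then obtain q where q: "p = \<one> # q" by (cases p) auto
    have qA: "set q \<subseteq> A" using p q by (auto simp: polynomial_def)
    have ev: "eval q x \<in> lspan A ((\<lambda>i. x [^] i) ` {..<length q})"
      using qA
    proof (induction q)
      case Nil
      then show ?case by (simp add: lspan.zero)
    next
      case (Cons a q)
      then show ?case
        using lspan_insert_subset[of a A "eval q x" _ "x [^] length q"]
        by (simp add: lessThan_Suc)
    qed
    have c: "eval q x \<in> carrier R" "x [^] length q \<in> carrier R"
      using ev lspan_carrier[OF A(1) S] assms(2) by auto
    have "x [^] length q \<oplus> eval q x = \<zero>" using p q c by simp
    then have "x [^] length q = \<ominus> eval q x" using c by (metis minus_equality)
    then show "\<exists>n::nat. x [^] n \<in> lspan A ((\<lambda>i. x [^] i) ` {..<n})"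
      using submod_uminus[OF assms(1) submod_lspan[OF assms(1) S] ev]
      by (intro exI[of _ "length q"]) simp
  }
  {
    assume "\<exists>n::nat. x [^] n \<in> lspan A ((\<lambda>i. x [^] i) ` {..<n})"
    then obtain n :: nat where n: "x [^] n \<in> lspan A ((\<lambda>i. x [^] i) ` {..<n})" by auto
    \<comment> \<open>The length must be exactly \<open>n\<close>, with leading zeros allowed in
      \<open>q\<close>, so that the 1 put in front of \<open>q\<close> becomes the coefficient of
      degree \<open>n\<close>.\<close>
    have ex: "\<exists>q. set q \<subseteq> A \<and> length q = n \<and> eval q x = y"
      if "y \<in> lspan A ((\<lambda>i. x [^] i) ` {..<n::nat})" for y n
      using that
    proof (induction n arbitrary: y)
      case 0
      have "y = \<zero>" using 0 by (cases rule: lspan.cases) auto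
      then show ?case by auto
    next
      case (Suc n)
      obtain a z where az: "a \<in> A" "z \<in> lspan A ((\<lambda>i. x [^] i) ` {..<n})" "y = a \<otimes> x [^] n \<oplus> z"
        using lspan_insertE[OF assms(1), of "x [^] n" "(\<lambda>i. x [^] i) ` {..<n}" y] Suc.prems S[of "Suc n"]
        by (auto simp: lessThan_Suc)
      obtain q where "set q \<subseteq> A" "length q = n" "eval q x = z" using Suc.IH[OF az(2)] by auto
      then show ?case using az by (intro exI[of _ "a # q"]) auto
    qed
    obtain q where q: "set q \<subseteq> A" "length q = n" "eval q x = \<ominus> (x [^] n)"
      using ex[OF submod_uminus[OF assms(1) submod_lspan[OF assms(1) S] n]] by auto
    have "eval (\<one> # q) x = \<zero>" using q assms(2) by (simp add: r_neg)
    moreover have "polynomial\<^bsub>R\<^esub> A (\<one> # q)" using q A(3) by (simp add: polynomial_def)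
    ultimately show "integral_over R A x" unfolding integral_over_def by (intro exI[of _ "\<one> # q"]) auto
  }
qed

lemma lspan_range_bounded:
  assumes "x \<in> lspan A (range (f :: nat \<Rightarrow> 'a))"
  shows "\<exists>n. x \<in> lspan A (f ` {..<n})"
  using assms
proof induction
  case (step a s y)
  then obtain n i where n: "y \<in> lspan A (f ` {..<n})" "s = f i" by auto
  have "y \<in> lspan A (f ` {..<max n (Suc i)})"
    using n(1) lspan_mono[OF subset_refl, of "f ` {..<n}" "f ` {..<max n (Suc i)}" A] by (auto simp: image_mono)
  moreover have "s \<in> f ` {..<max n (Suc i)}" using n(2) by auto
  ultimately show ?case using step by (blast intro: lspan.step)
qed (auto intro: lspan.zero)

text \<open>The powers of \<open>x\<close> span a submodule of a Noetherian module, so the chain of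
  the spans of \<open>1, x, \<dots>, x\<^sup>n\<^sup>-\<^sup>1\<close> becomes stationary.\<close>

lemma integral_over_of_fg:
  assumes "subring A R" "noeth A" "x \<in> carrier R" "finite S" "S \<subseteq> carrier R"
    and "c \<in> carrier R" "c \<noteq> \<zero>" and powers: "\<And>n::nat. c \<otimes> x [^] n \<in> lspan A S"
  shows "integral_over R A x"
proof -
  note A = subringE[OF assms(1)]
  define f :: "nat \<Rightarrow> 'a" where "f n = c \<otimes> x [^] n" for n
  have f: "range f \<subseteq> carrier R" using assms by (auto simp: f_def)
  have "fg A (lspan A (range f))"
  proof (rule fg_submod_of_lspan[OF assms(2,1,4,5) submod_lspan[OF assms(1) f]])
    show "lspan A (range f) \<subseteq> lspan A S"
      by (rule lspan_least[OF submod_lspan[OF assms(1,5)]]) (use powers in \<open>auto simp: f_def\<close>)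
  qed
  then obtain T where T: "finite T" "T \<subseteq> lspan A (range f)" "lspan A (range f) = lspan A T"
    by (auto simp: fg_def)
  have "\<forall>t\<in>T. \<exists>n. t \<in> lspan A (f ` {..<n})" using T lspan_range_bounded by blast
  then obtain b where b: "\<And>t. t \<in> T \<Longrightarrow> t \<in> lspan A (f ` {..<b t})" by metis
  \<comment> \<open>The inserted 0 keeps the maximum defined when \<open>T\<close> is empty.\<close>
  define n where "n = Max (insert 0 (b ` T))"
  have fn: "f ` {..<n} \<subseteq> carrier R" using f by auto
  have "T \<subseteq> lspan A (f ` {..<n})"
  proof
    fix t assume t: "t \<in> T"
    then have "b t \<le> n" using T by (auto simp: n_def)
    then show "t \<in> lspan A (f ` {..<n})"
      using b[OF t] lspan_mono[OF subset_refl, of "f ` {..<b t}" "f ` {..<n}" A]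
      by (auto simp: image_mono)
  qed
  then have "lspan A T \<subseteq> lspan A (f ` {..<n})"
    by (intro lspan_least[OF submod_lspan[OF assms(1) fn]])
  then have fnn: "f n \<in> lspan A (f ` {..<n})"
    using T(3) lspan_incl[OF assms(1) f] by blast
  \<comment> \<open>Each combination of the \<open>f i\<close> is \<open>c\<close> times the same
    combination of powers of \<open>x\<close>. Cancelling \<open>c\<close> in the relation for
    \<open>f n\<close> leaves the integral equation.\<close>
  have "\<exists>z\<in>lspan A ((\<lambda>i. x [^] i) ` {..<n}). y = c \<otimes> z" if "y \<in> lspan A (f ` {..<n})" for y
    using that
  proof induction
    case zero
    then show ?case using assms(6) by (auto intro!: bexI[of _ \<zero>] lspan.zero)
  next
    case (step a s y)
    then obtain z i where zi: "z \<in> lspan A ((\<lambda>i. x [^] i) ` {..<n})" "y = c \<otimes> z" "i < n" "s = f i"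
      by auto
    have cc: "a \<in> carrier R" "z \<in> carrier R" "x [^] i \<in> carrier R"
      using step zi A(1) assms(3) lspan_carrier[OF A(1), of "(\<lambda>i. x [^] i) ` {..<n}"] by auto
    have "a \<otimes> s \<oplus> y = c \<otimes> (a \<otimes> x [^] i \<oplus> z)"
      using cc zi assms(6) by (simp add: f_def r_distr m_lcomm)
    moreover have "a \<otimes> x [^] i \<oplus> z \<in> lspan A ((\<lambda>i. x [^] i) ` {..<n})"
      using step zi by (auto intro: lspan.step)
    ultimately show ?case by blast
  qed
  then obtain z where z: "z \<in> lspan A ((\<lambda>i. x [^] i) ` {..<n})" "f n = c \<otimes> z" using fnn by blast
  have "z \<in> carrier R" using z lspan_carrier[OF A(1), of "(\<lambda>i. x [^] i) ` {..<n}"] assms(3) by auto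
  then have "x [^] n = z" using z(2) assms(3,6,7) by (simp add: f_def m_lcancel)
  then show ?thesis using z(1) integral_over_iff[OF assms(1,3)] by auto
qed

text \<open>Replaces the determinant trick: a finite span that contains 1 and is stable under
  \<open>x\<close> contains all powers of \<open>x\<close>.\<close>

lemma integral_over_of_stable:
  assumes "subring A R" "noeth A" "x \<in> carrier R" "finite S" "S \<subseteq> carrier R"
    and "\<one> \<in> lspan A S" "\<And>s. s \<in> S \<Longrightarrow> x \<otimes> s \<in> lspan A S"
  shows "integral_over R A x"
proof (rule integral_over_of_fg[OF assms(1-5)])
  fix n :: nat
  have st: "x \<otimes> y \<in> lspan A S" if "y \<in> lspan A S" for y
    by (rule lspan_mult_stable[OF subringE(1)[OF assms(1)] assms(5,3) submod_lspan[OF assms(1,5)] _ that])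
      (rule assms(7))
  have "x [^] n \<in> lspan A S"
  proof (induction n)
    case 0
    then show ?case using assms(6) by simp
  next
    case (Suc n)
    then show ?case using st assms(3) by (simp add: m_comm)
  qed
  then show "\<one> \<otimes> x [^] n \<in> lspan A S" using assms(3) by simp
qed auto

lemma integral_over_self:
  assumes "subring A R" "noeth A" "a \<in> A"
  shows "integral_over R A a"
  by (rule integral_over_of_stable[OF assms(1,2), of _ "{\<one>}"])
    (use assms subringE(1)[OF assms(1)] lspan_incl[OF assms(1), of "{\<one>}"]
      lspan_smult[OF assms(1), of "{\<one>}" a \<one>] in auto)

text \<open>The finitely many products \<open>x [^] i \<otimes> y [^] j\<close> below the two
  degrees span a module that contains 1 and is stable under both \<open>x\<close> and
  \<open>y\<close>, hence under their sum and product.\<close>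

lemma integral_over_add_mult:
  assumes "subring A R" "noeth A" "x \<in> carrier R" "y \<in> carrier R"
    and "integral_over R A x" "integral_over R A y"
  shows "integral_over R A (x \<oplus> y)" "integral_over R A (x \<otimes> y)"
proof -
  note A = subringE[OF assms(1)]
  obtain n :: nat where n: "x [^] n \<in> lspan A ((\<lambda>i. x [^] i) ` {..<n})"
    using assms integral_over_iff by blast
  obtain m :: nat where m: "y [^] m \<in> lspan A ((\<lambda>i. y [^] i) ` {..<m})"
    using assms integral_over_iff by blast
  define S where "S = (\<lambda>i. x [^] i) ` {..<n}"
  define T where "T = (\<lambda>i. y [^] i) ` {..<m}"
  define V where "V = (\<lambda>(s, t). s \<otimes> t) ` (S \<times> T)"
  have S: "S \<subseteq> carrier R" "finite S" and T: "T \<subseteq> carrier R" "finite T"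
    using assms by (auto simp: S_def T_def)
  have V: "V \<subseteq> carrier R" "finite V" using S T by (auto simp: V_def)
  have pow: "x [^] i \<otimes> y [^] j \<in> lspan A V" for i j :: nat
    using lspan_mult[OF assms(1) S(1) T(1)] lspan_powers[OF assms(1,3) n] lspan_powers[OF assms(1,4) m]
    by (simp add: V_def S_def T_def)
  note sub = submod_lspan[OF assms(1) V(1)]
  have one: "\<one> \<in> lspan A V" using pow[of 0 0] by simp
  have st: "x \<otimes> s \<in> lspan A V \<and> y \<otimes> s \<in> lspan A V" if sV: "s \<in> V" for s
  proof -
    obtain i j where "s = x [^] (i::nat) \<otimes> y [^] (j::nat)" using sV by (auto simp: V_def S_def T_def)
    moreover have "x \<otimes> (x [^] i \<otimes> y [^] j) = x [^] Suc i \<otimes> y [^] j"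
      "y \<otimes> (x [^] i \<otimes> y [^] j) = x [^] i \<otimes> y [^] Suc j"
      using assms(3,4) by (simp_all add: m_ac)
    ultimately show ?thesis using pow by metis
  qed
  then have st': "x \<otimes> w \<in> lspan A V" if "w \<in> lspan A V" for w
    using lspan_mult_stable[OF A(1) V(1) assms(3) sub _ that] by blast
  show "integral_over R A (x \<oplus> y)"
  proof (rule integral_over_of_stable[OF assms(1,2) _ V(2,1) one])
    show "(x \<oplus> y) \<otimes> s \<in> lspan A V" if "s \<in> V" for s
      using st[OF that] submodD(3)[OF sub] assms(3,4) that V(1) by (auto simp: l_distr)
  qed (use assms in auto)
  show "integral_over R A (x \<otimes> y)"
  proof (rule integral_over_of_stable[OF assms(1,2) _ V(2,1) one])
    show "(x \<otimes> y) \<otimes> s \<in> lspan A V" if "s \<in> V" for s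
      using st[OF that] st' assms(3,4) that V(1) by (auto simp: m_assoc)
  qed (use assms in auto)
qed

lemma integral_closure_subring:
  assumes "subring A R" "noeth A"
  shows "subring (integral_closure R A) R"
proof (rule subringI)
  note A = subringE[OF assms(1)]
  show "integral_closure R A \<subseteq> carrier R" by (auto simp: integral_closure_def)
  show "\<one> \<in> integral_closure R A"
    using integral_over_self[OF assms A(3)] by (simp add: integral_closure_def)
  show "h1 \<otimes> h2 \<in> integral_closure R A" "h1 \<oplus> h2 \<in> integral_closure R A"
    if "h1 \<in> integral_closure R A" "h2 \<in> integral_closure R A" for h1 h2
    using that integral_over_add_mult[OF assms] by (auto simp: integral_closure_def)
  show "\<ominus> h \<in> integral_closure R A" if "h \<in> integral_closure R A" for h
  proof -
    have "integral_over R A (\<ominus> \<one> \<otimes> h)"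
      using that integral_over_self[OF assms A(5)[OF A(3)]]
      by (intro integral_over_add_mult[OF assms]) (auto simp: integral_closure_def)
    then show ?thesis using that by (simp add: integral_closure_def l_minus)
  qed
qed

lemma subset_integral_closure:
  assumes "subring A R" "noeth A"
  shows "A \<subseteq> integral_closure R A"
  using integral_over_self[OF assms] subringE(1)[OF assms(1)] by (auto simp: integral_closure_def)

lemma integral_over_hom:
  assumes "h \<in> ring_hom R R" "subring A R" "subring B R" "h ` A \<subseteq> B" "x \<in> carrier R" "integral_over R A x"
  shows "integral_over R B (h x)"
proof -
  interpret h: ring_hom_ring R R h
    by (rule ring_hom_ringI2[OF ring_axioms ring_axioms assms(1)])
  obtain n :: nat where n: "x [^] n \<in> lspan A ((\<lambda>i. x [^] i) ` {..<n})"
    using assms integral_over_iff by blast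
  have "h (x [^] n) \<in> lspan (h ` A) (h ` (\<lambda>i. x [^] i) ` {..<n})"
    by (rule lspan_hom[OF assms(1) _ _ n]) (use assms(5) subringE(1)[OF assms(2)] in auto)
  also have "\<dots> \<subseteq> lspan B ((\<lambda>i. h x [^] i) ` {..<n})"
    using assms(4,5) by (intro lspan_mono) (auto simp: h.hom_nat_pow)
  finally show ?thesis
    using integral_over_iff[OF assms(3)] assms(5) by (auto simp: h.hom_nat_pow)
qed

text \<open>Since \<open>B\<close> is finite over \<open>A\<close>, the powers of \<open>x\<close>
  lie in a finite \<open>A\<close>-span obtained from \<open>lspan_tower\<close>.\<close>

lemma integral_over_trans:
  assumes "subring A R" "noeth A" "subring B R" "fg A B" "x \<in> carrier R" "integral_over R B x"
  shows "integral_over R A x"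
proof -
  obtain T where T: "finite T" "T \<subseteq> B" "B = lspan A T" using assms(4) by (auto simp: fg_def)
  have Tc: "T \<subseteq> carrier R" using T subringE(1)[OF assms(3)] by auto
  obtain n :: nat where n: "x [^] n \<in> lspan B ((\<lambda>i. x [^] i) ` {..<n})"
    using assms integral_over_iff by blast
  let ?S = "(\<lambda>i. x [^] i) ` {..<n}"
  show ?thesis
  proof (rule integral_over_of_fg[OF assms(1,2,5)])
    show "\<one> \<otimes> x [^] j \<in> lspan A ((\<lambda>(t, s). t \<otimes> s) ` (T \<times> ?S))" for j :: nat
      using lspan_tower[OF assms(1) _ Tc _ lspan_powers[OF assms(3,5) n]] T assms(5) by auto
  qed (use T Tc assms(5) in auto)
qed

end

section \<open>Clearing denominators\<close>

context field begin

lemma subring_frac_memI: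
  assumes "subring A R" "a \<in> A"
  shows "a \<in> frac_field R A"
proof -
  have "a = a \<otimes> inv \<one>" using assms subringE(1)[OF assms(1)] by auto
  then show ?thesis using assms subringE(3)[OF assms(1)] unfolding frac_field_def by force
qed

lemma lspan_frac_denominator:
  assumes "subring A R" "S \<subseteq> carrier R" "y \<in> lspan (frac_field R A) S"
  shows "\<exists>d\<in>A. d \<noteq> \<zero> \<and> d \<otimes> y \<in> lspan A S"
  using assms(3)
proof induction
  case zero
  then show ?case using subringE(3)[OF assms(1)] by (auto intro!: bexI[of _ \<one>] lspan.zero)
next
  case (step b s y)
  note A = subringE[OF assms(1)]
  note N = submodD[OF submod_lspan[OF assms(1,2)]]
  obtain d where d: "d \<in> A" "d \<noteq> \<zero>" "d \<otimes> y \<in> lspan A S" using step by auto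
  obtain p q where pq: "p \<in> A" "q \<in> A" "q \<noteq> \<zero>" "b = p \<otimes> inv q"
    using step by (auto simp: frac_field_def)
  have iq: "inv q \<in> carrier R" "q \<otimes> inv q = \<one>" using pq A(1) field_Units by auto
  have "frac_field R A \<subseteq> carrier R" using A(1) field_Units by (auto simp: frac_field_def)
  then have c: "p \<in> carrier R" "q \<in> carrier R" "d \<in> carrier R" "s \<in> carrier R" "y \<in> carrier R"
    using pq d step assms(2) A(1) lspan_carrier[of "frac_field R A" S] by auto
  have "q \<otimes> b = p" using pq c iq by (simp add: m_lcomm)
  moreover have "(d \<otimes> q) \<otimes> (b \<otimes> s \<oplus> y) = (d \<otimes> (q \<otimes> b)) \<otimes> s \<oplus> q \<otimes> (d \<otimes> y)"
    using c pq(4) iq by (simp add: r_distr m_ac)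
  ultimately have "(d \<otimes> q) \<otimes> (b \<otimes> s \<oplus> y) = (d \<otimes> p) \<otimes> s \<oplus> q \<otimes> (d \<otimes> y)" by simp
  moreover have "(d \<otimes> p) \<otimes> s \<oplus> q \<otimes> (d \<otimes> y) \<in> lspan A S"
    using step d pq A(6) N(4) by (intro lspan.step) auto
  moreover have "d \<otimes> q \<noteq> \<zero>" using c d pq by (simp add: integral_iff)
  ultimately show ?case using d pq A(6) by (intro bexI[of _ "d \<otimes> q"]) auto
qed

text \<open>Choose \<open>d\<close> so that \<open>d \<otimes> x [^] n\<close> is an
  \<open>A\<close>-combination of lower powers. Then \<open>d \<otimes> x\<close> already maps the
  \<open>A\<close>-span of those powers into itself, so no powers of \<open>d\<close> have to be
  distributed over the equation.\<close>

lemma integral_multiple: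
  assumes "subring A R" "noeth A" "subring (frac_field R A) R" "x \<in> carrier R" "integral_over R (frac_field R A) x"
  shows "\<exists>d\<in>A. d \<noteq> \<zero> \<and> integral_over R A (d \<otimes> x)"
proof -
  note A = subringE[OF assms(1)]
  obtain n :: nat where n: "x [^] n \<in> lspan (frac_field R A) ((\<lambda>i. x [^] i) ` {..<n})"
    using assms integral_over_iff by blast
  let ?S = "(\<lambda>i. x [^] i) ` {..<n}"
  have S: "?S \<subseteq> carrier R" using assms by auto
  obtain d where d: "d \<in> A" "d \<noteq> \<zero>" "d \<otimes> x [^] n \<in> lspan A ?S"
    using lspan_frac_denominator[OF assms(1) S n] by auto
  have dc: "d \<in> carrier R" using d A(1) by auto
  \<comment> \<open>Needed so that 1, the zeroth power, is among the generators.\<close>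
  have n0: "n \<noteq> 0"
  proof
    assume "n = 0"
    then have "\<one> \<in> lspan (frac_field R A) {}" using n by simp
    then have "\<one> = \<zero>" by (cases rule: lspan.cases) auto
    then show False by simp
  qed
  have "integral_over R A (d \<otimes> x)"
  proof (rule integral_over_of_stable[OF assms(1,2) _ _ S])
    show "\<one> \<in> lspan A ?S" using lspan_incl[OF assms(1) S] n0 by force
    fix s assume "s \<in> ?S"
    then obtain i where i: "i < n" "s = x [^] i" by auto
    have eq: "(d \<otimes> x) \<otimes> s = d \<otimes> x [^] Suc i" using i assms(4) dc by (simp add: m_ac)
    show "(d \<otimes> x) \<otimes> s \<in> lspan A ?S"
    proof (cases "Suc i = n")
      case True
      then show ?thesis using eq d by simp
    next
      case False
      then have "x [^] Suc i \<in> ?S" using i by (intro imageI) auto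
      then have "x [^] Suc i \<in> lspan A ?S" using lspan_incl[OF assms(1) S] by blast
      then show ?thesis unfolding eq by (rule lspan_smult[OF assms(1) S d(1)])
    qed
  qed (use dc assms in auto)
  then show ?thesis using d by auto
qed

end

section \<open>Automorphisms\<close>

lemma alg_autsD:
  assumes "\<theta> \<in> alg_auts k A"
  shows "\<theta> \<in> Bij (carrier A)" "\<theta> \<in> ring_hom A A" "\<And>c. c \<in> k \<Longrightarrow> \<theta> c = c"
    "\<And>x. x \<in> carrier A \<Longrightarrow> \<theta> x \<in> carrier A"
    "\<And>x y. \<lbrakk>x \<in> carrier A; y \<in> carrier A\<rbrakk> \<Longrightarrow> \<theta> (x \<oplus>\<^bsub>A\<^esub> y) = \<theta> x \<oplus>\<^bsub>A\<^esub> \<theta> y"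
    "\<And>x y. \<lbrakk>x \<in> carrier A; y \<in> carrier A\<rbrakk> \<Longrightarrow> \<theta> (x \<otimes>\<^bsub>A\<^esub> y) = \<theta> x \<otimes>\<^bsub>A\<^esub> \<theta> y"
    "\<theta> \<one>\<^bsub>A\<^esub> = \<one>\<^bsub>A\<^esub>"
  using assms ring_iso_memE[of \<theta> A A] by (auto simp: alg_auts_def Bij_def ring_iso_def)

lemma alg_autsI:
  assumes "\<theta> \<in> Bij (carrier A)" "\<And>c. c \<in> k \<Longrightarrow> \<theta> c = c"
    and "\<And>x y. \<lbrakk>x \<in> carrier A; y \<in> carrier A\<rbrakk> \<Longrightarrow> \<theta> (x \<oplus>\<^bsub>A\<^esub> y) = \<theta> x \<oplus>\<^bsub>A\<^esub> \<theta> y"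
    and "\<And>x y. \<lbrakk>x \<in> carrier A; y \<in> carrier A\<rbrakk> \<Longrightarrow> \<theta> (x \<otimes>\<^bsub>A\<^esub> y) = \<theta> x \<otimes>\<^bsub>A\<^esub> \<theta> y"
    and "\<theta> \<one>\<^bsub>A\<^esub> = \<one>\<^bsub>A\<^esub>"
  shows "\<theta> \<in> alg_auts k A"
proof -
  have "bij_betw \<theta> (carrier A) (carrier A)" "\<theta> \<in> extensional (carrier A)"
    using assms(1) by (auto simp: Bij_def)
  moreover have "\<theta> \<in> ring_hom A A"
    using assms Bij_imp_funcset[OF assms(1)] by (intro ring_hom_memI) auto
  ultimately show ?thesis using assms(2) by (auto simp: alg_auts_def ring_iso_def)
qed

lemma BijGroup_simps:
  "carrier (BijGroup S) = Bij S"
  "\<one>\<^bsub>BijGroup S\<^esub> = (\<lambda>x\<in>S. x)"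
  "\<lbrakk>f \<in> Bij S; g \<in> Bij S\<rbrakk> \<Longrightarrow> f \<otimes>\<^bsub>BijGroup S\<^esub> g = compose S f g"
  by (auto simp: BijGroup_def)

lemma BijGroup_inv_apply:
  assumes "f \<in> Bij S" "x \<in> S"
  shows "(inv\<^bsub>BijGroup S\<^esub> f) x \<in> S" "f ((inv\<^bsub>BijGroup S\<^esub> f) x) = x" "(inv\<^bsub>BijGroup S\<^esub> f) (f x) = x"
  using assms by (auto simp: inv_BijGroup Bij_def bij_betw_def f_inv_into_f inv_into_into)

lemma alg_auts_subgroup:
  assumes "ring A" "k \<subseteq> carrier A"
  shows "subgroup (alg_auts k A) (BijGroup (carrier A))"
proof (rule group.subgroupI[OF group_BijGroup])
  interpret ring A by fact
  show "alg_auts k A \<subseteq> carrier (BijGroup (carrier A))"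
    by (auto simp: BijGroup_simps dest: alg_autsD(1))
  have "(\<lambda>x\<in>carrier A. x) \<in> alg_auts k A"
    by (rule alg_autsI[OF id_Bij]) (use assms in auto)
  then show "alg_auts k A \<noteq> {}" by auto
  fix \<theta> assume \<theta>: "\<theta> \<in> alg_auts k A"
  let ?\<tau> = "inv\<^bsub>BijGroup (carrier A)\<^esub> \<theta>"
  note s = alg_autsD[OF \<theta>] and t = BijGroup_inv_apply[OF alg_autsD(1)[OF \<theta>]]
  show "?\<tau> \<in> alg_auts k A"
  proof (rule alg_autsI)
    show "?\<tau> \<in> Bij (carrier A)"
      using s(1) group.inv_closed[OF group_BijGroup, of \<theta>] by (auto simp: BijGroup_simps)
    show "?\<tau> c = c" if "c \<in> k" for c
      using t(3)[of c] s(3)[OF that] that assms(2) by auto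
    show "?\<tau> (x \<oplus>\<^bsub>A\<^esub> y) = ?\<tau> x \<oplus>\<^bsub>A\<^esub> ?\<tau> y" "?\<tau> (x \<otimes>\<^bsub>A\<^esub> y) = ?\<tau> x \<otimes>\<^bsub>A\<^esub> ?\<tau> y"
      if "x \<in> carrier A" "y \<in> carrier A" for x y
    proof -
      have "?\<tau> (\<theta> (?\<tau> x \<oplus>\<^bsub>A\<^esub> ?\<tau> y)) = ?\<tau> x \<oplus>\<^bsub>A\<^esub> ?\<tau> y"
        using t that by simp
      then show "?\<tau> (x \<oplus>\<^bsub>A\<^esub> y) = ?\<tau> x \<oplus>\<^bsub>A\<^esub> ?\<tau> y" using t(1,2) that by (simp add: s(5))
      have "?\<tau> (\<theta> (?\<tau> x \<otimes>\<^bsub>A\<^esub> ?\<tau> y)) = ?\<tau> x \<otimes>\<^bsub>A\<^esub> ?\<tau> y"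
        using t that by simp
      then show "?\<tau> (x \<otimes>\<^bsub>A\<^esub> y) = ?\<tau> x \<otimes>\<^bsub>A\<^esub> ?\<tau> y" using t(1,2) that by (simp add: s(6))
    qed
    show "?\<tau> \<one>\<^bsub>A\<^esub> = \<one>\<^bsub>A\<^esub>" using t(3)[of "\<one>\<^bsub>A\<^esub>"] s(7) by auto
  qed
  fix \<rho> assume \<rho>: "\<rho> \<in> alg_auts k A"
  note r = alg_autsD[OF \<rho>]
  have "compose (carrier A) \<theta> \<rho> \<in> alg_auts k A"
    by (rule alg_autsI[OF compose_Bij[OF s(1) r(1)]])
      (use s(2-7) r(2-7) assms(2) in \<open>auto simp: compose_def\<close>)
  then show "\<theta> \<otimes>\<^bsub>BijGroup (carrier A)\<^esub> \<rho> \<in> alg_auts k A"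
    using s(1) r(1) by (simp add: BijGroup_simps)
qed

lemma alg_aut_group:
  assumes "ring A" "k \<subseteq> carrier A"
  shows "group (alg_aut_group k A)"
  using subgroup.subgroup_is_group[OF alg_auts_subgroup[OF assms] group_BijGroup]
  by (simp add: alg_aut_group_def)

lemma alg_auts_antimono: "k \<subseteq> K \<Longrightarrow> alg_auts K A \<subseteq> alg_auts k A"
  by (auto simp: alg_auts_def)

section \<open>Finiteness of the automorphism group over a subfield\<close>

context field begin

text \<open>Makes the integrality criteria available over K, where they say that a finite extension
  is algebraic. A nonzero ideal of a field is generated by any of its nonzero elements.\<close>

lemma noeth_subfield:
  assumes "subfield K R"
  shows "noeth K"
  unfolding noeth_def
proof (intro allI impI)
  note K = subringE[OF subfieldE(1)[OF assms]]
  fix I assume I: "submod K I \<and> I \<subseteq> K"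
  show "fg K I"
  proof (cases "I = {\<zero>}")
    case True
    have "x = \<zero>" if "x \<in> lspan K {}" for x using that by cases auto
    then have "I = lspan K {}" using True by (auto intro: lspan.zero)
    then show ?thesis unfolding fg_def by blast
  next
    case False
    then obtain a where a: "a \<in> I" "a \<noteq> \<zero>" using I submodD(2) by blast
    then have aK: "a \<in> K - {\<zero>}" using I by auto
    have "I = lspan K {a}"
    proof
      show "lspan K {a} \<subseteq> I" using lspan_least[of K I "{a}"] I a by auto
      show "I \<subseteq> lspan K {a}"
      proof
        fix x assume "x \<in> I"
        then have x: "x \<in> K" using I by auto
        have "x \<otimes> inv a \<in> K" using x subfield_m_inv(1)[OF assms aK] K(6) by auto
        then have "(x \<otimes> inv a) \<otimes> a \<oplus> \<zero> \<in> lspan K {a}" by (intro lspan.intros) auto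
        moreover have "(x \<otimes> inv a) \<otimes> a \<oplus> \<zero> = x"
          using x aK K(1) subfield_m_inv[OF assms aK] by (auto simp: m_assoc subset_eq)
        ultimately show "x \<in> lspan K {a}" by simp
      qed
    qed
    then show ?thesis using a unfolding fg_def by blast
  qed
qed

lemma finite_dimension_lspan:
  assumes "subfield K R" "finite_dimension K (carrier R)"
  obtains S where "finite S" "S \<subseteq> carrier R" "lspan K S = carrier R"
proof -
  obtain n where "dimension n K (carrier R)" using assms(2) by (auto simp: finite_dimension_def)
  then obtain Vs where Vs: "set Vs \<subseteq> carrier R" "Span K Vs = carrier R"
    using exists_base[OF assms(1)] by blast
  have "combine Ks Us \<in> lspan K (set Us)" if "set Ks \<subseteq> K" for Ks Us
    using that
  proof (induction Ks Us rule: combine.induct)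
    case (1 k Ks u Us)
    then have "combine Ks Us \<in> lspan K (set (u # Us))"
      using lspan_mono[of K K "set Us" "set (u # Us)"] by auto
    then show ?case using 1 by (auto intro: lspan.step)
  qed (auto intro: lspan.zero)
  then have "carrier R \<subseteq> lspan K (set Vs)"
    unfolding Vs(2)[symmetric] Span_eq_combine_set[OF assms(1) Vs(1)] by blast
  moreover have "lspan K (set Vs) \<subseteq> carrier R"
    by (rule lspan_carrier[OF subfieldE(3)[OF assms(1)] Vs(1)])
  ultimately have "lspan K (set Vs) = carrier R" by blast
  with Vs(1) show thesis by (intro that[of "set Vs"]) simp_all
qed

text \<open>An automorphism fixing \<open>K\<close> commutes with evaluation of \<open>p\<close>, so
  it sends \<open>x\<close> to one of the finitely many roots of \<open>p\<close>.\<close>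

lemma finite_roots_of_integral:
  assumes "subring K R" "x \<in> carrier R" "integral_over R K x"
  shows "\<exists>Z. finite Z \<and> (\<forall>\<theta>\<in>alg_auts K R. \<theta> x \<in> Z)"
proof -
  note K = subringE[OF assms(1)]
  obtain p where p: "polynomial\<^bsub>R\<^esub> K p" "p \<noteq> []" "eval p x = \<zero>"
    using assms(3) by (auto simp: integral_over_def)
  have pK: "set p \<subseteq> K" using p by (auto simp: polynomial_def)
  have "polynomial\<^bsub>R\<^esub> (carrier R) p" using p K(1) by (auto simp: polynomial_def)
  then have fin: "finite {y. is_root p y}"
    by (intro finite_number_of_roots) (simp add: univ_poly_carrier)
  have "is_root p (\<theta> x)" if s: "\<theta> \<in> alg_auts K R" for \<theta>
  proof -
    note s = alg_autsD[OF s]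
    interpret h: ring_hom_ring R R \<theta>
      by (rule ring_hom_ringI2[OF ring_axioms ring_axioms s(2)])
    have "eval q (\<theta> x) = \<theta> (eval q x)" if "set q \<subseteq> K" for q
      using that
    proof (induction q)
      case (Cons a q)
      then have "a \<in> carrier R" "set q \<subseteq> carrier R" "\<theta> a = a" using K(1) s(3) by auto
      then show ?case using Cons assms(2) eval_in_carrier by (simp add: h.hom_nat_pow)
    qed simp
    then show ?thesis using p pK s(4)[OF assms(2)] by (simp add: is_root_def)
  qed
  then show ?thesis using fin by blast
qed

text \<open>An automorphism over \<open>K\<close> is determined by its values on \<open>S\<close>,
  each of which has finitely many candidates.\<close>

lemma finite_alg_auts:
  assumes "subring K R" "finite S" "S \<subseteq> carrier R" "lspan K S = carrier R"
    and "\<And>s. s \<in> S \<Longrightarrow> integral_over R K s"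
  shows "finite (alg_auts K R)"
proof -
  note K = subringE[OF assms(1)]
  have "\<forall>s\<in>S. \<exists>Z. finite Z \<and> (\<forall>\<theta>\<in>alg_auts K R. \<theta> s \<in> Z)"
    using finite_roots_of_integral[OF assms(1)] assms(3,5) by blast
  then obtain Z where Z: "\<And>s. s \<in> S \<Longrightarrow> finite (Z s)"
    "\<And>s \<theta>. \<lbrakk>s \<in> S; \<theta> \<in> alg_auts K R\<rbrakk> \<Longrightarrow> \<theta> s \<in> Z s" by metis
  have "(\<lambda>\<theta>. restrict \<theta> S) ` alg_auts K R \<subseteq> PiE S Z" using Z by (auto simp: PiE_iff)
  then have "finite ((\<lambda>\<theta>. restrict \<theta> S) ` alg_auts K R)"
    using finite_PiE[OF assms(2), of Z] Z finite_subset by blast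
  moreover have "inj_on (\<lambda>\<theta>. restrict \<theta> S) (alg_auts K R)"
  proof (rule inj_onI)
    fix \<theta> \<tau> assume h: "\<theta> \<in> alg_auts K R" "\<tau> \<in> alg_auts K R" "restrict \<theta> S = restrict \<tau> S"
    note s = alg_autsD[OF h(1)] and t = alg_autsD[OF h(2)]
    interpret s: ring_hom_ring R R \<theta>
      by (rule ring_hom_ringI2[OF ring_axioms ring_axioms s(2)])
    interpret t: ring_hom_ring R R \<tau>
      by (rule ring_hom_ringI2[OF ring_axioms ring_axioms t(2)])
    have eq: "\<theta> x = \<tau> x" if "x \<in> S" for x using fun_cong[OF h(3), of x] that by simp
    have "\<theta> x = \<tau> x" if "x \<in> lspan K S" for x
      using that
    proof induction
      case (step a u y)
      have "a \<in> carrier R" "u \<in> carrier R" "y \<in> carrier R" using step K(1) assms(3,4) by auto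
      then show ?case using step eq s(3) t(3) by simp
    qed simp
    then show "\<theta> = \<tau>"
      using s(1) t(1) assms(4) by (intro extensionalityI[of _ "carrier R"]) (auto simp: Bij_def)
  qed
  ultimately show ?thesis using finite_image_iff by blast
qed

end

section \<open>Integral closure in a Galois extension\<close>

locale galois_ext = field R for R (structure) +
  fixes A
  assumes subring: "subring A R" and noeth: "noeth A"
    and galois: "finite_galois (frac_field R A) R"
begin

abbreviation "K \<equiv> frac_field R A"
abbreviation "G \<equiv> alg_auts K R"
abbreviation "\<Lambda> \<equiv> integral_closure R A"

lemmas A_closed = subringE[OF subring]

lemma subfield_K: "subfield K R" using galois by (simp add: finite_galois_def)

lemmas K_closed = subringE[OF subfieldE(1)[OF subfield_K]]

lemma AK: "A \<subseteq> K" using subring_frac_memI[OF subring] by blast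

lemma spanning:
  obtains S where "finite S" "S \<subseteq> carrier R" "lspan K S = carrier R"
  using finite_dimension_lspan[OF subfield_K] galois by (auto simp: finite_galois_def)

lemma integral_over_K:
  assumes "x \<in> carrier R"
  shows "integral_over R K x"
proof -
  obtain S where S: "finite S" "S \<subseteq> carrier R" "lspan K S = carrier R" by (rule spanning)
  then show ?thesis
    using integral_over_of_fg[OF subfieldE(1)[OF subfield_K] noeth_subfield[OF subfield_K] assms S(1,2), of \<one>] assms
    by simp
qed

text \<open>Used twice: to write R as the fraction field of \<Lambda>, and to move a spanning set
  over K into \<Lambda>.\<close>

lemma denominator:
  assumes "x \<in> carrier R"
  shows "\<exists>d\<in>A. d \<noteq> \<zero> \<and> d \<otimes> x \<in> \<Lambda>"
proof -
  obtain d where "d \<in> A" "d \<noteq> \<zero>" "integral_over R A (d \<otimes> x)"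
    using integral_multiple[OF subring noeth subfieldE(1)[OF subfield_K] assms integral_over_K[OF assms]] by blast
  then show ?thesis using assms A_closed(1) by (auto simp: integral_closure_def)
qed

text \<open>\<open>finite_galois\<close> speaks of the dimension and the fixed field, whereas the
  trace is a sum over \<open>G\<close> and the orbit in \<open>ex_coeff_nonzero\<close> has to be
  finite.\<close>

lemma finite_G: "finite G"
proof -
  obtain S where S: "finite S" "S \<subseteq> carrier R" "lspan K S = carrier R" by (rule spanning)
  then show ?thesis using finite_alg_auts[OF subfieldE(1)[OF subfield_K] S] integral_over_K by blast
qed

lemma subgroup_G: "subgroup G (BijGroup (carrier R))"
  by (rule alg_auts_subgroup[OF ring_axioms K_closed(1)])

lemma fixed_field: "x \<in> K \<longleftrightarrow> x \<in> carrier R \<and> (\<forall>\<theta>\<in>G. \<theta> x = x)"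
  using galois by (auto simp: finite_galois_def)

section \<open>The trace\<close>

definition tr :: "'a \<Rightarrow> 'a" where "tr x = (\<Oplus>\<theta>\<in>G. \<theta> x)"

lemma G_apply_Pi: "x \<in> carrier R \<Longrightarrow> (\<lambda>\<theta>. \<theta> x) \<in> G \<rightarrow> carrier R"
  by (auto dest: alg_autsD)

lemma tr_add: "\<lbrakk>x \<in> carrier R; y \<in> carrier R\<rbrakk> \<Longrightarrow> tr (x \<oplus> y) = tr x \<oplus> tr y"
proof -
  assume h: "x \<in> carrier R" "y \<in> carrier R"
  have "tr (x \<oplus> y) = (\<Oplus>\<theta>\<in>G. \<theta> x \<oplus> \<theta> y)"
    unfolding tr_def by (rule finsum_cong') (use h in \<open>auto dest: alg_autsD\<close>)
  then show ?thesis using h by (simp add: tr_def G_apply_Pi finsum_addf)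
qed

lemma tr_mult: "\<lbrakk>a \<in> K; x \<in> carrier R\<rbrakk> \<Longrightarrow> tr (a \<otimes> x) = a \<otimes> tr x"
proof -
  assume h: "a \<in> K" "x \<in> carrier R"
  have a: "a \<in> carrier R" using h K_closed(1) by auto
  have "tr (a \<otimes> x) = (\<Oplus>\<theta>\<in>G. a \<otimes> \<theta> x)"
    unfolding tr_def by (rule finsum_cong') (use h a in \<open>auto simp: alg_autsD\<close>)
  then show ?thesis using finsum_rdistr[OF finite_G a G_apply_Pi] h by (simp add: tr_def)
qed

text \<open>Left multiplication by \<open>\<tau>\<close> is injective on the finite set
  \<open>G\<close>, hence permutes the summands; so the trace lies in the fixed field.\<close>

lemma tr_in_K: "x \<in> carrier R \<Longrightarrow> tr x \<in> K"
proof -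
  assume x: "x \<in> carrier R"
  have "\<tau> (tr x) = tr x" if t: "\<tau> \<in> G" for \<tau>
  proof -
    let ?B = "BijGroup (carrier R)"
    interpret B: group ?B by (rule group_BijGroup)
    note GB = subgroup.subset[OF subgroup_G]
    interpret h: ring_hom_ring R R \<tau>
      by (rule ring_hom_ringI2[OF ring_axioms ring_axioms alg_autsD(2)[OF t]])
    have inj: "inj_on (\<lambda>\<theta>. \<tau> \<otimes>\<^bsub>?B\<^esub> \<theta>) G"
      using t GB by (intro inj_onI) (auto simp: subset_eq)
    have im: "(\<lambda>\<theta>. \<tau> \<otimes>\<^bsub>?B\<^esub> \<theta>) ` G = G"
      using inj finite_G subgroup.m_closed[OF subgroup_G t]
      by (intro endo_inj_surj) auto
    have "tr x = (\<Oplus>\<theta>\<in>(\<lambda>\<theta>. \<tau> \<otimes>\<^bsub>?B\<^esub> \<theta>) ` G. \<theta> x)" unfolding im tr_def ..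
    also have "\<dots> = (\<Oplus>\<theta>\<in>G. (\<tau> \<otimes>\<^bsub>?B\<^esub> \<theta>) x)"
      by (rule add.finprod_reindex) (use inj im G_apply_Pi[OF x] in auto)
    also have "\<dots> = (\<Oplus>\<theta>\<in>G. \<tau> (\<theta> x))"
      by (rule finsum_cong') (use x t in \<open>auto simp: BijGroup_simps compose_def alg_autsD\<close>)
    also have "\<dots> = \<tau> (tr x)"
      using h.hom_finsum[OF G_apply_Pi[OF x]] by (simp add: tr_def comp_def)
    finally show ?thesis ..
  qed
  moreover have "tr x \<in> carrier R" unfolding tr_def by (rule finsum_closed[OF G_apply_Pi[OF x]])
  ultimately show ?thesis using fixed_field by blast
qed

lemma subring_closure: "subring \<Lambda> R" by (rule integral_closure_subring[OF subring noeth])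

lemma A_le_closure: "A \<subseteq> \<Lambda>" by (rule subset_integral_closure[OF subring noeth])

lemma G_closure: "\<lbrakk>\<theta> \<in> G; x \<in> \<Lambda>\<rbrakk> \<Longrightarrow> \<theta> x \<in> \<Lambda>"
proof -
  assume h: "\<theta> \<in> G" "x \<in> \<Lambda>"
  have "\<theta> ` A \<subseteq> A" using alg_autsD(3)[OF h(1)] AK by (auto simp: subset_eq)
  then show ?thesis
    using h integral_over_hom[OF alg_autsD(2)[OF h(1)] subring subring] alg_autsD(4)[OF h(1)]
    by (auto simp: integral_closure_def)
qed

lemma frac_closure: "frac_field R \<Lambda> = carrier R"
proof
  note L = subringE[OF subring_closure]
  show "frac_field R \<Lambda> \<subseteq> carrier R"
    using L(1) field_Units by (auto simp: frac_field_def)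
  show "carrier R \<subseteq> frac_field R \<Lambda>"
  proof
    fix x assume x: "x \<in> carrier R"
    then obtain d where d: "d \<in> A" "d \<noteq> \<zero>" "d \<otimes> x \<in> \<Lambda>" using denominator by blast
    have "d \<in> Units R" using d A_closed(1) field_Units by auto
    then have "x = (d \<otimes> x) \<otimes> inv d"
      using x by (simp add: m_comm[OF Units_closed x] m_assoc Units_closed)
    then show "x \<in> frac_field R \<Lambda>" using d A_le_closure unfolding frac_field_def by blast
  qed
qed

end

section \<open>Finiteness of the integral closure over a normal domain\<close>

locale normal_galois_ext = galois_ext +
  assumes char0: "\<And>n::nat. n > 0 \<Longrightarrow> [n] \<cdot> \<one> \<noteq> \<zero>"
    and closed: "integrally_closed_domain R A"
begin

lemma closure_inter_K: "\<Lambda> \<inter> K = A"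
  using closed A_le_closure AK by (auto simp: integrally_closed_domain_def integral_closure_def)

text \<open>The conjugates of \<open>x\<close> stay integral, so the trace lies in
  \<open>\<Lambda> \<inter> K\<close>, which is \<open>A\<close> because \<open>A\<close> is
  integrally closed.\<close>

lemma tr_closure: "x \<in> \<Lambda> \<Longrightarrow> tr x \<in> A"
proof -
  assume x: "x \<in> \<Lambda>"
  note L = subringE[OF subring_closure]
  have xR: "x \<in> carrier R" using x L(1) by auto
  have "finsum R (\<lambda>\<theta>. \<theta> x) F \<in> \<Lambda>" if "F \<subseteq> G" for F
    using finite_subset[OF that finite_G] that
  proof (induction F rule: finite_induct)
    case (insert \<theta> F)
    then have "(\<lambda>\<theta>. \<theta> x) \<in> F \<rightarrow> carrier R" "\<theta> x \<in> carrier R" using G_apply_Pi[OF xR] by auto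
    then show ?case using insert G_closure[OF _ x] L(7) by simp
  qed (use L in simp)
  then have "tr x \<in> \<Lambda>" by (simp add: tr_def)
  then show ?thesis using closure_inter_K tr_in_K[OF xR] by auto
qed

text \<open>Characteristic zero enters here.\<close>

lemma tr_one: "tr \<one> \<noteq> \<zero>"
proof -
  have "tr \<one> = (\<Oplus>\<theta>\<in>G. \<one>)"
    unfolding tr_def by (rule finsum_cong') (auto simp: alg_autsD)
  also have "\<dots> = [card G] \<cdot> \<one>" by (simp add: add.finprod_const)
  finally have "tr \<one> = [card G] \<cdot> \<one>" .
  moreover have "G \<noteq> {}" using subgroup.one_closed[OF subgroup_G] by auto
  ultimately show ?thesis using char0 finite_G by (simp add: card_gt_0_iff)
qed

text \<open>The maps \<open>x \<mapsto> tr (x b)\<close>, for \<open>b\<close> in a \<open>K\<close>-spanning subset of \<open>\<Lambda>\<close>, embed \<open>\<Lambda>\<close>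
  into a finite power of \<open>A\<close>: the trace form is nondegenerate because \<open>tr \<one> = |G| \<noteq> 0\<close>.\<close>

lemma fg_submod_closure:
  assumes N: "submod A N" "N \<subseteq> \<Lambda>"
  shows "fg A N"
proof -
  note L = subringE[OF subring_closure]
  obtain S where S: "finite S" "S \<subseteq> carrier R" "lspan K S = carrier R" by (rule spanning)
  \<comment> \<open>Scaling \<open>s\<close> by \<open>d s\<close> moves it into \<Lambda>, so that
    the functionals in \<open>F\<close> take values in \<open>A\<close> on \<open>N\<close>. As
    \<open>d s\<close> is a nonzero element of K, it can be divided out again below.\<close>
  have "\<forall>s\<in>S. \<exists>d. d \<in> A \<and> d \<noteq> \<zero> \<and> d \<otimes> s \<in> \<Lambda>" using denominator S(2) by blast
  then obtain d where d: "\<And>s. s \<in> S \<Longrightarrow> d s \<in> A" "\<And>s. s \<in> S \<Longrightarrow> d s \<noteq> \<zero>" "\<And>s. s \<in> S \<Longrightarrow> d s \<otimes> s \<in> \<Lambda>"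
    by metis
  define F where "F = (\<lambda>s x. tr (x \<otimes> (d s \<otimes> s))) ` S"
  show ?thesis
  proof (rule fg_functionals[OF noeth subring _ N(1), of F])
    show "finite F" using S by (simp add: F_def)
    show "f x \<in> A" if h: "f \<in> F" "x \<in> N" for f x
    proof -
      obtain s where s: "s \<in> S" "f = (\<lambda>x. tr (x \<otimes> (d s \<otimes> s)))" using h by (auto simp: F_def)
      have "x \<otimes> (d s \<otimes> s) \<in> \<Lambda>" by (rule L(6)) (use that N(2) d(3)[OF s(1)] in auto)
      then show ?thesis using tr_closure s by simp
    qed
    show "f (x \<oplus> y) = f x \<oplus> f y" if h: "f \<in> F" "x \<in> N" "y \<in> N" for f x y
    proof -
      obtain s where s: "s \<in> S" "f = (\<lambda>x. tr (x \<otimes> (d s \<otimes> s)))" using h by (auto simp: F_def)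
      have "x \<in> carrier R" "y \<in> carrier R" "d s \<otimes> s \<in> carrier R"
        using that N(2) L(1) d(3)[OF s(1)] by auto
      then show ?thesis by (simp add: s l_distr tr_add)
    qed
    show "f (a \<otimes> x) = a \<otimes> f x" if h: "f \<in> F" "a \<in> A" "x \<in> N" for f a x
    proof -
      obtain s where s: "s \<in> S" "f = (\<lambda>x. tr (x \<otimes> (d s \<otimes> s)))" using h by (auto simp: F_def)
      have "x \<in> carrier R" "a \<in> carrier R" "d s \<otimes> s \<in> carrier R" "a \<in> K"
        using that N(2) L(1) A_closed(1) AK d(3)[OF s(1)] by auto
      then show ?thesis by (simp add: s m_assoc tr_mult)
    qed
    show "x = \<zero>" if x: "x \<in> N" and 0: "\<forall>f\<in>F. f x = \<zero>" for x
    proof (rule ccontr)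
      assume nz: "x \<noteq> \<zero>"
      have xR: "x \<in> carrier R" using x N(2) L(1) by auto
      have trS: "tr (x \<otimes> s) = \<zero>" if s: "s \<in> S" for s
      proof -
        have c: "s \<in> carrier R" "d s \<in> carrier R" "d s \<in> K" using s S(2) d(1) A_closed(1) AK by auto
        have "tr (x \<otimes> (d s \<otimes> s)) = \<zero>" using 0 s by (auto simp: F_def)
        moreover have "x \<otimes> (d s \<otimes> s) = d s \<otimes> (x \<otimes> s)" using c xR by (simp add: m_lcomm)
        ultimately have "d s \<otimes> tr (x \<otimes> s) = \<zero>" using c xR by (simp add: tr_mult)
        then show ?thesis using c d(2)[OF s] tr_in_K[of "x \<otimes> s"] xR K_closed(1) integral_iff by auto
      qed
      have "tr (x \<otimes> y) = \<zero>" if "y \<in> lspan K S" for y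
        using that
      proof induction
        case zero
        have "tr (x \<otimes> \<zero>) = tr (\<zero> \<otimes> \<zero>)" using xR by simp
        also have "\<dots> = \<zero>" using tr_mult[OF K_closed(2), of \<zero>] tr_in_K[of \<zero>] K_closed(1) by auto
        finally show ?case .
      next
        case (step a s y)
        have c: "a \<in> carrier R" "s \<in> carrier R" "y \<in> carrier R" using step K_closed(1) S by auto
        have "x \<otimes> (a \<otimes> s \<oplus> y) = a \<otimes> (x \<otimes> s) \<oplus> x \<otimes> y"
          using c xR by (simp add: r_distr m_lcomm)
        then show ?case using c xR step trS by (simp add: tr_add tr_mult)
      qed
      \<comment> \<open>The trace of \<open>x \<otimes> y\<close> now vanishes for every
        \<open>y\<close>; taking \<open>y\<close> to be the inverse of \<open>x\<close> gives trace
        of 1 equal to 0.\<close>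
      moreover have "x \<in> Units R" using xR nz field_Units by auto
      ultimately have "tr \<one> = \<zero>" using S(3) by (metis Units_inv_closed Units_r_inv)
      then show False using tr_one by simp
    qed
  qed
qed

lemma fg_closure: "fg A \<Lambda>"
proof (rule fg_submod_closure)
  note L = subringE[OF subring_closure]
  show "submod A \<Lambda>"
    unfolding submod_def using L(1,2,6,7) A_le_closure by blast
qed simp

text \<open>Transitivity of integrality, available since \<open>fg_closure\<close> makes \<Lambda>
  finite over \<open>A\<close>.\<close>

lemma integral_over_closure:
  assumes "x \<in> carrier R" "integral_over R \<Lambda> x"
  shows "x \<in> \<Lambda>"
  using integral_over_trans[OF subring noeth subring_closure fg_closure assms] assms(1)
  by (simp add: integral_closure_def)

text \<open>An ideal of \<Lambda> is in particular an \<open>A\<close>-submodule, hence finitely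
  generated over \<open>A\<close>, and the same elements generate it as an ideal.\<close>

lemma noetherian_closure: "noetherian_domain (R\<lparr>carrier := \<Lambda>\<rparr>)"
proof -
  note L = subringE[OF subring_closure]
  interpret D: domain "R\<lparr>carrier := \<Lambda>\<rparr>" by (rule subring_is_domain[OF subring_closure])
  have "noetherian_ring (R\<lparr>carrier := \<Lambda>\<rparr>)"
  proof (rule D.noetherian_ringI)
    fix I assume I: "ideal I (R\<lparr>carrier := \<Lambda>\<rparr>)"
    interpret I: ideal I "R\<lparr>carrier := \<Lambda>\<rparr>" by fact
    have IL: "I \<subseteq> \<Lambda>" using I.a_subset by simp
    have "submod A I"
      unfolding submod_def
      using IL L(1) A_le_closure I.a_closed I.I_l_closed I.zero_closed by (auto simp: subset_eq)
    then obtain T where T: "finite T" "T \<subseteq> I" "I = lspan A T"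
      using fg_submod_closure[OF _ IL] by (auto simp: fg_def)
    have TL: "T \<subseteq> carrier (R\<lparr>carrier := \<Lambda>\<rparr>)" using T IL by auto
    interpret J: ideal "Idl\<^bsub>R\<lparr>carrier := \<Lambda>\<rparr>\<^esub> T" "R\<lparr>carrier := \<Lambda>\<rparr>"
      by (rule D.genideal_ideal[OF TL])
    have "submod A (Idl\<^bsub>R\<lparr>carrier := \<Lambda>\<rparr>\<^esub> T)"
      unfolding submod_def
      using J.a_subset L(1) A_le_closure J.a_closed J.I_l_closed J.zero_closed by (auto simp: subset_eq)
    then have "I \<subseteq> Idl\<^bsub>R\<lparr>carrier := \<Lambda>\<rparr>\<^esub> T"
      using lspan_least D.genideal_self[OF TL] T(3) by blast
    moreover have "Idl\<^bsub>R\<lparr>carrier := \<Lambda>\<rparr>\<^esub> T \<subseteq> I"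
      by (rule D.genideal_minimal[OF I T(2)])
    ultimately show "\<exists>B\<subseteq>carrier (R\<lparr>carrier := \<Lambda>\<rparr>). finite B \<and> I = Idl\<^bsub>R\<lparr>carrier := \<Lambda>\<rparr>\<^esub> B"
      using T(1) TL by blast
  qed
  then show ?thesis using D.domain_axioms by (simp add: noetherian_domain_def)
qed

end

section \<open>Coefficients in skew monoid rings\<close>

context field begin

lemma skew_add_apply: "m \<in> M \<Longrightarrow> (f \<oplus>\<^bsub>skew_monoid_ring R M\<^esub> h) m = f m \<oplus> h m"
  by (simp add: skew_monoid_ring_def)

lemma skew_carrierD: "\<lbrakk>f \<in> carrier (skew_monoid_ring R M); m \<in> M\<rbrakk> \<Longrightarrow> f m \<in> carrier R"
  by (auto simp: skew_monoid_ring_def)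

context
  fixes k M
  assumes M: "M \<subseteq> alg_auts k R" and one: "\<one>\<^bsub>BijGroup (carrier R)\<^esub> \<in> M"
begin

text \<open>An embedded scalar is supported at the identity, so at most one pair contributes to each
  coefficient. The asymmetry between \<open>m a\<close> and \<open>a\<close> is what turns
  finiteness conditions on U into integrality of \<open>m a\<close>.\<close>

lemma skew_mult_emb:
  assumes f: "f \<in> carrier (skew_monoid_ring R M)" and a: "a \<in> carrier R" and m: "m \<in> M"
  shows "(f \<otimes>\<^bsub>skew_monoid_ring R M\<^esub> skew_emb R M a) m = f m \<otimes> m a"
    and "(skew_emb R M a \<otimes>\<^bsub>skew_monoid_ring R M\<^esub> f) m = a \<otimes> f m"
proof -
  let ?B = "BijGroup (carrier R)"
  interpret B: group ?B by (rule group_BijGroup)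
  have MB: "p \<in> carrier ?B" if "p \<in> M" for p
    using alg_autsD(1)[OF subsetD[OF M that]] by (simp add: BijGroup_simps)
  note mM = subsetD[OF M m]
  have mz: "m \<zero> = \<zero>" by (rule ring_hom_zero[OF alg_autsD(2)[OF mM] ring_axioms ring_axioms])
  have ma: "m a \<in> carrier R" by (rule alg_autsD(4)[OF mM a])
  have fm: "f m \<in> carrier R" by (rule skew_carrierD[OF f m])
  have one_a: "\<one>\<^bsub>?B\<^esub> x = x" if "x \<in> carrier R" for x using that by (simp add: BijGroup_simps)
  have emb1: "skew_emb R M a \<one>\<^bsub>?B\<^esub> = a" using one by (simp add: skew_emb_def)
  have emb0: "q = \<one>\<^bsub>?B\<^esub>" if "q \<in> M" "skew_emb R M a q \<noteq> \<zero>" for q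
    using that by (auto simp: skew_emb_def split: if_splits)
  \<comment> \<open>The product runs over pairs with nonzero coefficients. The index sets are
    therefore singletons, or empty when \<open>f m\<close> or \<open>a\<close> is zero, and then the
    claimed value is zero too.\<close>
  let ?P = "{(p, q). p \<in> M \<and> q \<in> M \<and> f p \<noteq> \<zero> \<and> skew_emb R M a q \<noteq> \<zero> \<and> p \<otimes>\<^bsub>?B\<^esub> q = m}"
  let ?Q = "{(p, q). p \<in> M \<and> q \<in> M \<and> skew_emb R M a p \<noteq> \<zero> \<and> f q \<noteq> \<zero> \<and> p \<otimes>\<^bsub>?B\<^esub> q = m}"
  have P1: "p = m \<and> q = \<one>\<^bsub>?B\<^esub> \<and> f m \<noteq> \<zero> \<and> a \<noteq> \<zero>"
    if "p \<in> M" "q \<in> M" "f p \<noteq> \<zero>" "skew_emb R M a q \<noteq> \<zero>" "p \<otimes>\<^bsub>?B\<^esub> q = m" for p q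
  proof -
    have q: "q = \<one>\<^bsub>?B\<^esub>" by (rule emb0[OF that(2,4)])
    then show ?thesis using that MB[OF that(1)] emb1 by simp
  qed
  have Q1: "p = \<one>\<^bsub>?B\<^esub> \<and> q = m \<and> f m \<noteq> \<zero> \<and> a \<noteq> \<zero>"
    if "p \<in> M" "q \<in> M" "skew_emb R M a p \<noteq> \<zero>" "f q \<noteq> \<zero>" "p \<otimes>\<^bsub>?B\<^esub> q = m" for p q
  proof -
    have p: "p = \<one>\<^bsub>?B\<^esub>" by (rule emb0[OF that(1,3)])
    then show ?thesis using that MB[OF that(2)] emb1 by simp
  qed
  have PQ2: "(m, \<one>\<^bsub>?B\<^esub>) \<in> ?P" "(\<one>\<^bsub>?B\<^esub>, m) \<in> ?Q" if "f m \<noteq> \<zero> \<and> a \<noteq> \<zero>"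
    using that emb1 m one MB[OF m] by simp_all
  have P: "?P = (if f m \<noteq> \<zero> \<and> a \<noteq> \<zero> then {(m, \<one>\<^bsub>?B\<^esub>)} else {})"
  proof (cases "f m \<noteq> \<zero> \<and> a \<noteq> \<zero>")
    case True
    have "?P \<subseteq> {(m, \<one>\<^bsub>?B\<^esub>)}" using P1 by blast
    moreover have "{(m, \<one>\<^bsub>?B\<^esub>)} \<subseteq> ?P"
      using PQ2(1)[OF True] by (simp only: insert_subset empty_subsetI simp_thms)
    ultimately have "?P = {(m, \<one>\<^bsub>?B\<^esub>)}" by (rule subset_antisym)
    then show ?thesis using True by (simp only: if_True simp_thms)
  next
    case False
    then have "?P = {}" using P1 by blast
    then show ?thesis using False by (simp only: if_False)
  qed
  have Q: "?Q = (if f m \<noteq> \<zero> \<and> a \<noteq> \<zero> then {(\<one>\<^bsub>?B\<^esub>, m)} else {})"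
  proof (cases "f m \<noteq> \<zero> \<and> a \<noteq> \<zero>")
    case True
    have "?Q \<subseteq> {(\<one>\<^bsub>?B\<^esub>, m)}" using Q1 by blast
    moreover have "{(\<one>\<^bsub>?B\<^esub>, m)} \<subseteq> ?Q"
      using PQ2(2)[OF True] by (simp only: insert_subset empty_subsetI simp_thms)
    ultimately have "?Q = {(\<one>\<^bsub>?B\<^esub>, m)}" by (rule subset_antisym)
    then show ?thesis using True by (simp only: if_True simp_thms)
  next
    case False
    then have "?Q = {}" using Q1 by blast
    then show ?thesis using False by (simp only: if_False)
  qed
  have "(f \<otimes>\<^bsub>skew_monoid_ring R M\<^esub> skew_emb R M a) m =
      finsum R (\<lambda>(p, q). f p \<otimes> p (skew_emb R M a q)) ?P"
    using m by (simp add: skew_monoid_ring_def)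
  then show "(f \<otimes>\<^bsub>skew_monoid_ring R M\<^esub> skew_emb R M a) m = f m \<otimes> m a"
    unfolding P using fm ma mz emb1 by (auto simp: finsum_insert Pi_def)
  have "(skew_emb R M a \<otimes>\<^bsub>skew_monoid_ring R M\<^esub> f) m =
      finsum R (\<lambda>(p, q). skew_emb R M a p \<otimes> p (f q)) ?Q"
    using m by (simp add: skew_monoid_ring_def)
  then show "(skew_emb R M a \<otimes>\<^bsub>skew_monoid_ring R M\<^esub> f) m = a \<otimes> f m"
    unfolding Q using fm a one_a emb1 by (auto simp: finsum_insert Pi_def)
qed

lemma ideal_prod_left_apply:
  assumes "subring A R" "m \<in> M" "S \<subseteq> carrier (skew_monoid_ring R M)"
    and "f \<in> ideal_prod (skew_monoid_ring R M) (skew_emb R M ` A) S"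
  shows "f m \<in> lspan A ((\<lambda>s. s m) ` S)"
  using assms(4)
proof induction
  note A = subringE[OF assms(1)]
  have S: "(\<lambda>s. s m) ` S \<subseteq> carrier R" using assms(2,3) skew_carrierD by blast
  {
    case (prod i j)
    then obtain a where a: "a \<in> A" "i = skew_emb R M a" by auto
    have "j m \<in> lspan A ((\<lambda>s. s m) ` S)" using prod lspan_incl[OF assms(1) S] by blast
    then show ?case
      using skew_mult_emb(2)[OF subsetD[OF assms(3) prod(2)] subsetD[OF A(1) a(1)] assms(2)]
        lspan_smult[OF assms(1) S a(1)] a(2) by simp
  next
    case (sum f g)
    then show ?case
      using submodD(3)[OF submod_lspan[OF assms(1) S]] by (simp add: skew_add_apply assms(2))
  }
qed

lemma ideal_prod_right_apply:
  assumes "subring A R" "m \<in> M" "S \<subseteq> carrier (skew_monoid_ring R M)"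
    and "f \<in> ideal_prod (skew_monoid_ring R M) S (skew_emb R M ` A)"
  shows "f m \<in> lspan (m ` A) ((\<lambda>s. s m) ` S)"
  using assms(4)
proof induction
  note A = subringE[OF assms(1)]
  have mh: "m \<in> ring_hom R R" using M assms(2) alg_autsD(2) by blast
  interpret h: ring_hom_ring R R m
    by (rule ring_hom_ringI2[OF ring_axioms ring_axioms mh])
  have mA: "subring (m ` A) R" by (rule h.img_is_subring[OF assms(1)])
  have S: "(\<lambda>s. s m) ` S \<subseteq> carrier R" using assms(2,3) skew_carrierD by blast
  {
    case (prod j i)
    then obtain a where a: "a \<in> A" "i = skew_emb R M a" by auto
    have j: "j m \<in> lspan (m ` A) ((\<lambda>s. s m) ` S)" using prod lspan_incl[OF mA S] by blast
    have c: "m a \<in> carrier R" "j m \<in> carrier R" using a A(1) prod S by auto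
    have "m a \<otimes> j m \<in> lspan (m ` A) ((\<lambda>s. s m) ` S)"
      using lspan_smult[OF mA S _ j] a by blast
    then show ?case
      using skew_mult_emb(1)[OF subsetD[OF assms(3) prod(1)] subsetD[OF A(1) a(1)] assms(2)]
        a(2) c by (simp add: m_comm)
  next
    case (sum f g)
    then show ?case
      using submodD(3)[OF submod_lspan[OF mA S]] by (simp add: skew_add_apply assms(2))
  }
qed

text \<open>If \<open>\<Gamma> u \<Gamma>\<close> is finitely generated over \<open>\<Gamma>\<close> and the coefficient of \<open>m\<close> in \<open>u\<close> is nonzero,
  then comparing the coefficients of \<open>m\<close> in \<open>u \<gamma>\<^sup>n\<close> and \<open>\<gamma>\<^sup>n u\<close> bounds the powers of
  \<open>m \<gamma>\<close> and of \<open>m\<^sup>-\<^sup>1 \<gamma>\<close>.\<close>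

lemma quasicentral_integral:
  assumes A: "subring A R" "noeth A"
    and U: "subring U (skew_monoid_ring R M)" "skew_emb R M ` A \<subseteq> U"
    and qc: "quasicentral (skew_emb R M ` A) ((skew_monoid_ring R M)\<lparr>carrier := U\<rparr>)"
    and u: "u \<in> U" "u m \<noteq> \<zero>" and m: "m \<in> M" and a: "a \<in> A"
  shows "integral_over R A (m a)" "integral_over R A ((inv\<^bsub>BijGroup (carrier R)\<^esub> m) a)"
proof -
  let ?S = "skew_monoid_ring R M" and ?A = "skew_emb R M ` A"
  note As = subringE[OF A(1)] and Us = subringE[OF U(1)]
  define V where "V = ideal_prod ?S (ideal_prod ?S ?A {u}) ?A"
  \<comment> \<open>\<open>ideal_prod\<close> uses only addition and multiplication, so shrinking
    the carrier to \<open>U\<close> leaves it unchanged.\<close>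
  have ip: "ideal_prod (?S\<lparr>carrier := U\<rparr>) Z Y = ideal_prod ?S Z Y" for Z Y
  proof (intro equalityI subsetI)
    fix x
    show "x \<in> ideal_prod ?S Z Y" if "x \<in> ideal_prod (?S\<lparr>carrier := U\<rparr>) Z Y"
      using that by induction (auto intro: ideal_prod.intros)
    show "x \<in> ideal_prod (?S\<lparr>carrier := U\<rparr>) Z Y" if "x \<in> ideal_prod ?S Z Y"
      using that
    proof induction
      case (prod i j)
      then show ?case using ideal_prod.prod[of i Z j Y "?S\<lparr>carrier := U\<rparr>"] by simp
    next
      case (sum x y)
      then show ?case using ideal_prod.sum[of x "?S\<lparr>carrier := U\<rparr>" Z Y y] by simp
    qed
  qed
  have ipU: "ideal_prod ?S Z Y \<subseteq> U" if XY: "Z \<subseteq> U" "Y \<subseteq> U" for Z Y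
  proof
    fix x assume "x \<in> ideal_prod ?S Z Y"
    then show "x \<in> U" by induction (use XY Us(6,7) in auto)
  qed
  have VU: "V \<subseteq> U" unfolding V_def using u(1) U(2) by (intro ipU) auto
  have "(\<exists>S. finite S \<and> S \<subseteq> V \<and> V = ideal_prod ?S ?A S) \<and>
      (\<exists>T. finite T \<and> T \<subseteq> V \<and> V = ideal_prod ?S T ?A)"
    using qc u(1) by (simp add: quasicentral_def ip Let_def V_def)
  then obtain S T where S: "finite S" "S \<subseteq> V" "V = ideal_prod ?S ?A S"
    and T: "finite T" "T \<subseteq> V" "V = ideal_prod ?S T ?A"
    by blast
  have Sc: "S \<subseteq> carrier ?S" and Tc: "T \<subseteq> carrier ?S" and uc: "u \<in> carrier ?S"
    using S T VU Us(1) u(1) by blast+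
  have um: "u m \<in> carrier R" by (rule skew_carrierD[OF uc m])
  have mM: "m \<in> alg_auts k R" using m M by auto
  interpret h: ring_hom_ring R R m
    by (rule ring_hom_ringI2[OF ring_axioms ring_axioms alg_autsD(2)[OF mM]])
  have ac: "a \<in> carrier R" using a As(1) by auto
  have pA: "a [^] n \<in> A" for n :: nat
    using a As(3,6) by (induction n) auto
  \<comment> \<open>Used with \<open>b\<close> = 1 and \<open>c\<close> a power of \<open>a\<close>
    for the left side, and with the roles exchanged for the right side.\<close>
  have val: "\<exists>v\<in>V. v m = (b \<otimes> u m) \<otimes> m c" if bc: "b \<in> A" "c \<in> A" for b c
  proof -
    have bcc: "b \<in> carrier R" "c \<in> carrier R" using bc As(1) by auto
    let ?x = "skew_emb R M b \<otimes>\<^bsub>?S\<^esub> u"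
    have xU: "?x \<in> U" using bc U(2) u(1) Us(6) by blast
    have "?x \<otimes>\<^bsub>?S\<^esub> skew_emb R M c \<in> V"
      unfolding V_def using bc by (intro ideal_prod.prod) auto
    moreover have "(?x \<otimes>\<^bsub>?S\<^esub> skew_emb R M c) m = (b \<otimes> u m) \<otimes> m c"
      using skew_mult_emb(1)[of ?x c m] skew_mult_emb(2)[OF uc bcc(1) m] xU Us(1) bcc m by auto
    ultimately show ?thesis by blast
  qed
  have fin: "finite ((\<lambda>s. s m) ` S)" "finite ((\<lambda>s. s m) ` T)" using S T by auto
  have sub: "(\<lambda>s. s m) ` S \<subseteq> carrier R" "(\<lambda>s. s m) ` T \<subseteq> carrier R"
    using Sc Tc m skew_carrierD by blast+
  show "integral_over R A (m a)"
  proof (rule integral_over_of_fg[OF A _ fin(1) sub(1) um u(2)])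
    fix n :: nat
    obtain v where "v \<in> V" "v m = (\<one> \<otimes> u m) \<otimes> m (a [^] n)" using val[OF As(3) pA] by blast
    then show "u m \<otimes> m a [^] n \<in> lspan A ((\<lambda>s. s m) ` S)"
      using ideal_prod_left_apply[OF A(1) m Sc, of v] S(3) um ac by (simp add: h.hom_nat_pow)
  qed (use ac in auto)
  let ?i = "inv\<^bsub>BijGroup (carrier R)\<^esub> m"
  define i where "i = ?i"
  note im = BijGroup_inv_apply[OF alg_autsD(1)[OF mM], folded i_def]
  have mi: "i \<in> ring_hom R R"
  proof (rule ring_hom_memI)
    show "i \<one> = \<one>" using im(3)[of \<one>] by simp
    show "i (x \<otimes> y) = i x \<otimes> i y" "i (x \<oplus> y) = i x \<oplus> i y" if "x \<in> carrier R" "y \<in> carrier R" for x y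
      using im(3)[of "i x \<otimes> i y"] im(3)[of "i x \<oplus> i y"] im(1,2) that by auto
  qed (use im in auto)
  interpret i: ring_hom_ring R R i
    by (rule ring_hom_ringI2[OF ring_axioms ring_axioms mi])
  have iu: "i (u m) \<noteq> \<zero>" using im(2)[OF um] u(2) by auto
  have imA: "i ` m ` A = A" using im(3) As(1) by (force simp: image_iff subset_eq)
  have sT: "i ` (\<lambda>s. s m) ` T \<subseteq> carrier R" using sub(2) by auto
  have "integral_over R A (i a)"
  proof (rule integral_over_of_fg[OF A _ finite_imageI[OF fin(2), of i] sT _ iu])
    fix n :: nat
    obtain v where v: "v \<in> V" "v m = (a [^] n \<otimes> u m) \<otimes> m \<one>" using val[OF pA As(3)] by blast
    then have "a [^] n \<otimes> u m \<in> lspan (m ` A) ((\<lambda>s. s m) ` T)"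
      using ideal_prod_right_apply[OF A(1) m Tc, of v] T(3) um ac by simp
    then have "i (a [^] n \<otimes> u m) \<in> lspan (i ` m ` A) (i ` (\<lambda>s. s m) ` T)"
      by (rule lspan_hom[OF mi _ sub(2), rotated]) (use As(1) in auto)
    then show "i (u m) \<otimes> i a [^] n \<in> lspan A (i ` (\<lambda>s. s m) ` T)"
      using um ac unfolding imA by (simp add: i.hom_nat_pow m_comm)
  qed (use ac um in auto)
  then show "integral_over R A (?i a)" by (simp add: i_def)
qed

text \<open>The witness is the sum of the conjugates of \<open>m\<close>, which is \<open>G\<close>-invariant.\<close>

lemma ex_coeff_nonzero:
  assumes G: "subgroup G (BijGroup (carrier R))" "finite G" "G \<subseteq> alg_auts k R"
    and conj: "\<And>g m. \<lbrakk>g \<in> G; m \<in> M\<rbrakk> \<Longrightarrow> conj_by R g m \<in> M"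
    and U: "U \<subseteq> carrier (skew_monoid_ring R M)" and K: "K \<subseteq> carrier R"
    and gen: "ideal_prod (skew_monoid_ring R M) U (skew_emb R M ` K) = skew_invariants R M G"
    and m: "m \<in> M"
  shows "\<exists>u\<in>U. u m \<noteq> \<zero>"
proof (rule ccontr)
  assume no: "\<not> (\<exists>u\<in>U. u m \<noteq> \<zero>)"
  let ?B = "BijGroup (carrier R)"
  interpret B: group ?B by (rule group_BijGroup)
  note GB = subgroup.subset[OF G(1)]
  have MB: "p \<in> carrier ?B" if "p \<in> M" for p
    using alg_autsD(1)[OF subsetD[OF M that]] by (simp add: BijGroup_simps)
  \<comment> \<open>The orbit of \<open>m\<close> under conjugation. Finiteness of \<open>G\<close>
    gives \<open>e\<close> finite support, and the constant coefficient 1 is fixed by every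
    automorphism.\<close>
  define Om where "Om = (\<lambda>g. conj_by R g m) ` G"
  define e where "e = (\<lambda>p\<in>M. if p \<in> Om then \<one> else \<zero>)"
  have act: "conj_by R g (conj_by R h p) = conj_by R (g \<otimes>\<^bsub>?B\<^esub> h) p"
    if "g \<in> G" "h \<in> G" "p \<in> M" for g h p
  proof -
    have "g \<in> carrier ?B" "h \<in> carrier ?B" "p \<in> carrier ?B" using that GB MB by auto
    then show ?thesis by (simp add: conj_by_def B.m_assoc B.inv_mult_group)
  qed
  have Om_closed: "conj_by R g p \<in> Om" if "g \<in> G" "p \<in> Om" for g p
    using that act m subgroup.m_closed[OF G(1)] by (auto simp: Om_def)
  have one_act: "conj_by R \<one>\<^bsub>?B\<^esub> p = p" if "p \<in> M" for p
    using MB[OF that] by (simp add: conj_by_def)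
  \<comment> \<open>\<open>skew_act\<close> reads coefficients at conjugates by the inverse of
    \<open>g\<close>, so invariance of \<open>e\<close> needs the orbit to be preserved in both
    directions.\<close>
  have Om_iff: "conj_by R (inv\<^bsub>?B\<^esub> g) p \<in> Om \<longleftrightarrow> p \<in> Om" if g: "g \<in> G" and p: "p \<in> M" for g p
  proof
    have gi: "inv\<^bsub>?B\<^esub> g \<in> G" using subgroup.m_inv_closed[OF G(1) g] .
    show "conj_by R (inv\<^bsub>?B\<^esub> g) p \<in> Om" if "p \<in> Om" by (rule Om_closed[OF gi that])
    assume "conj_by R (inv\<^bsub>?B\<^esub> g) p \<in> Om"
    then have "conj_by R g (conj_by R (inv\<^bsub>?B\<^esub> g) p) \<in> Om" by (rule Om_closed[OF g])
    moreover have "g \<otimes>\<^bsub>?B\<^esub> inv\<^bsub>?B\<^esub> g = \<one>\<^bsub>?B\<^esub>" using g GB by auto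
    ultimately show "p \<in> Om" using act[OF g gi p] one_act[OF p] by simp
  qed
  have "e \<in> carrier (skew_monoid_ring R M)"
  proof -
    have "{p \<in> M. e p \<noteq> \<zero>} \<subseteq> Om" by (auto simp: e_def)
    moreover have "finite Om" using G(2) by (simp add: Om_def)
    ultimately have "finite {p \<in> M. e p \<noteq> \<zero>}" by (rule finite_subset)
    then show ?thesis by (auto simp: skew_monoid_ring_def e_def)
  qed
  moreover have "skew_act R M g e = e" if g: "g \<in> G" for g
  proof
    fix p
    have ga: "g \<in> alg_auts k R" using g G(3) by auto
    have g01: "g \<one> = \<one>" "g \<zero> = \<zero>"
      using alg_autsD(7)[OF ga] ring_hom_zero[OF alg_autsD(2)[OF ga] ring_axioms ring_axioms] by auto
    show "skew_act R M g e p = e p"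
    proof (cases "p \<in> M")
      case True
      have "conj_by R (inv\<^bsub>?B\<^esub> g) p \<in> M"
        using conj[OF subgroup.m_inv_closed[OF G(1) g] True] .
      then show ?thesis using True g01 Om_iff[OF g True] by (simp add: skew_act_def e_def)
    qed (simp add: skew_act_def e_def)
  qed
  ultimately have "e \<in> ideal_prod (skew_monoid_ring R M) U (skew_emb R M ` K)"
    unfolding gen by (simp add: skew_invariants_def)
  \<comment> \<open>At \<open>m\<close>, a product of \<open>u\<close> with an embedded scalar has
    coefficient \<open>u m\<close> times a scalar, which is zero by assumption; but
    \<open>e m\<close> is 1.\<close>
  then have "e m = \<zero>"
  proof induction
    case (prod u i)
    then obtain a where a: "a \<in> K" "i = skew_emb R M a" by auto
    have "m a \<in> carrier R" by (rule alg_autsD(4)[OF subsetD[OF M m] subsetD[OF K a(1)]])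
    moreover have "u m = \<zero>" using no prod(1) by blast
    ultimately show ?case using skew_mult_emb(1)[OF subsetD[OF U prod(1)] subsetD[OF K a(1)] m] a(2) by simp
  next
    case (sum f g)
    then show ?case by (simp add: skew_add_apply m)
  qed
  moreover have "m \<in> Om"
    unfolding Om_def using one_act[OF m] subgroup.one_closed[OF G(1)] by force
  then have "e m = \<one>" using m by (simp add: e_def)
  ultimately show False by simp
qed

end

lemma alg_auts_frac:
  assumes "subring B R" "\<theta> \<in> alg_auts k R" "a \<in> B" "b \<in> B" "b \<noteq> \<zero>"
  shows "\<theta> (a \<otimes> inv b) = \<theta> a \<otimes> inv (\<theta> b)"
proof -
  note s = alg_autsD[OF assms(2)]
  have c: "a \<in> carrier R" "b \<in> Units R" using assms subringE(1)[OF assms(1)] field_Units by auto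
  have "\<theta> b \<otimes> \<theta> (inv b) = \<theta> (b \<otimes> inv b)" using c by (intro s(6)[symmetric]) auto
  then have "\<theta> b \<otimes> \<theta> (inv b) = \<one>" using c s(7) by simp
  then have "inv (\<theta> b) = \<theta> (inv b)" using c s(4) by (intro comm_inv_char) auto
  then show ?thesis using c s(6) by simp
qed

end

section \<open>Restriction to the integral closure\<close>

context galois_ext begin

text \<open>Together the inclusions say that \<theta> maps \<Lambda> onto itself. They are kept
  apart because \<open>quasicentral_integral\<close> delivers one for \<open>m\<close> and one for
  its inverse.\<close>

definition stab :: "'a set \<Rightarrow> ('a \<Rightarrow> 'a) set" where
  "stab k = {\<theta> \<in> alg_auts k R. \<theta> ` \<Lambda> \<subseteq> \<Lambda> \<and> (inv\<^bsub>BijGroup (carrier R)\<^esub> \<theta>) ` \<Lambda> \<subseteq> \<Lambda>}"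

lemma restrict_stab:
  assumes k: "k \<subseteq> \<Lambda>" and \<theta>: "\<theta> \<in> stab k"
  shows "restrict \<theta> \<Lambda> \<in> alg_auts k (R\<lparr>carrier := \<Lambda>\<rparr>)"
proof (rule alg_autsI)
  note L = subringE[OF subring_closure]
  have t: "\<theta> \<in> alg_auts k R" and im: "\<And>x. x \<in> \<Lambda> \<Longrightarrow> \<theta> x \<in> \<Lambda>"
    "\<And>x. x \<in> \<Lambda> \<Longrightarrow> (inv\<^bsub>BijGroup (carrier R)\<^esub> \<theta>) x \<in> \<Lambda>"
    using \<theta> by (auto simp: stab_def)
  note s = alg_autsD[OF t]
  note i = BijGroup_inv_apply[OF s(1)]
  have "bij_betw \<theta> \<Lambda> \<Lambda>"
    by (rule bij_betwI[where g = "inv\<^bsub>BijGroup (carrier R)\<^esub> \<theta>"])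
      (use im i L(1) in auto)
  then show "restrict \<theta> \<Lambda> \<in> Bij (carrier (R\<lparr>carrier := \<Lambda>\<rparr>))"
    by (simp add: Bij_def)
  show "restrict \<theta> \<Lambda> c = c" if "c \<in> k" for c
    using that k s(3) by auto
  show "restrict \<theta> \<Lambda> (x \<oplus>\<^bsub>R\<lparr>carrier := \<Lambda>\<rparr>\<^esub> y) = restrict \<theta> \<Lambda> x \<oplus>\<^bsub>R\<lparr>carrier := \<Lambda>\<rparr>\<^esub> restrict \<theta> \<Lambda> y"
    "restrict \<theta> \<Lambda> (x \<otimes>\<^bsub>R\<lparr>carrier := \<Lambda>\<rparr>\<^esub> y) = restrict \<theta> \<Lambda> x \<otimes>\<^bsub>R\<lparr>carrier := \<Lambda>\<rparr>\<^esub> restrict \<theta> \<Lambda> y"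
    if "x \<in> carrier (R\<lparr>carrier := \<Lambda>\<rparr>)" "y \<in> carrier (R\<lparr>carrier := \<Lambda>\<rparr>)" for x y
    using that L(1,6,7) s(5,6) by (auto simp: subset_eq)
  show "restrict \<theta> \<Lambda> \<one>\<^bsub>R\<lparr>carrier := \<Lambda>\<rparr>\<^esub> = \<one>\<^bsub>R\<lparr>carrier := \<Lambda>\<rparr>\<^esub>" using L(3) s(7) by simp
qed

lemma stab_localization:
  assumes "\<theta> \<in> stab k"
  shows "is_localization_of R \<Lambda> \<theta> (restrict \<theta> \<Lambda>)"
  using assms alg_auts_frac[OF subring_closure] by (auto simp: is_localization_of_def stab_def)

text \<open>\<open>H\<close> is only closed under products, so that the lemma serves both the group
  \<open>G\<close> and the monoid M. Restriction is injective because every element of R is a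
  fraction of elements of \<Lambda>.\<close>

lemma restrict_mon:
  assumes k: "k \<subseteq> \<Lambda>" and H: "H \<subseteq> stab k"
    and closed: "\<And>x y. \<lbrakk>x \<in> H; y \<in> H\<rbrakk> \<Longrightarrow> x \<otimes>\<^bsub>BijGroup (carrier R)\<^esub> y \<in> H"
  shows "(\<lambda>\<theta>. restrict \<theta> \<Lambda>) \<in> mon ((alg_aut_group k R)\<lparr>carrier := H\<rparr>) (alg_aut_group k (R\<lparr>carrier := \<Lambda>\<rparr>))"
proof -
  note L = subringE[OF subring_closure]
  have res: "restrict \<theta> \<Lambda> \<in> alg_auts k (R\<lparr>carrier := \<Lambda>\<rparr>)" if "\<theta> \<in> H" for \<theta>
    using restrict_stab[OF k] that H by blast
  have Ht: "\<theta> \<in> alg_auts k R" "\<theta> \<in> Bij (carrier R)" if "\<theta> \<in> H" for \<theta>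
  proof -
    show "\<theta> \<in> alg_auts k R" using that H by (auto simp: stab_def)
    then show "\<theta> \<in> Bij (carrier R)" by (rule alg_autsD(1))
  qed
  have "restrict (\<theta> \<otimes>\<^bsub>BijGroup (carrier R)\<^esub> \<eta>) \<Lambda> =
      restrict \<theta> \<Lambda> \<otimes>\<^bsub>BijGroup \<Lambda>\<^esub> restrict \<eta> \<Lambda>" if h: "\<theta> \<in> H" "\<eta> \<in> H" for \<theta> \<eta>
  proof -
    have "restrict \<theta> \<Lambda> \<in> Bij \<Lambda>" "restrict \<eta> \<Lambda> \<in> Bij \<Lambda>"
      using alg_autsD(1)[OF res] h by auto
    moreover have "\<eta> x \<in> \<Lambda>" if "x \<in> \<Lambda>" for x using h(2) H that by (auto simp: stab_def)
    ultimately show ?thesis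
      using Ht[OF h(1)] Ht[OF h(2)] L(1)
      by (auto simp: BijGroup_simps compose_def restrict_def fun_eq_iff)
  qed
  then have "(\<lambda>\<theta>. restrict \<theta> \<Lambda>) \<in> hom ((alg_aut_group k R)\<lparr>carrier := H\<rparr>) (alg_aut_group k (R\<lparr>carrier := \<Lambda>\<rparr>))"
    using res by (intro homI) (auto simp: alg_aut_group_def)
  moreover have "inj_on (\<lambda>\<theta>. restrict \<theta> \<Lambda>) H"
  proof (rule inj_onI)
    fix \<theta> \<eta> assume h: "\<theta> \<in> H" "\<eta> \<in> H" "restrict \<theta> \<Lambda> = restrict \<eta> \<Lambda>"
    have eq: "\<theta> x = \<eta> x" if "x \<in> \<Lambda>" for x using fun_cong[OF h(3), of x] that by simp
    have "\<theta> x = \<eta> x" if x: "x \<in> carrier R" for x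
    proof -
      obtain a b where "a \<in> \<Lambda>" "b \<in> \<Lambda>" "b \<noteq> \<zero>" "x = a \<otimes> inv b"
        using x frac_closure unfolding frac_field_def by blast
      then show ?thesis
        using alg_auts_frac[OF subring_closure Ht(1)[OF h(1)]]
          alg_auts_frac[OF subring_closure Ht(1)[OF h(2)]] eq by simp
    qed
    then show "\<theta> = \<eta>"
      using Ht(2)[OF h(1)] Ht(2)[OF h(2)] by (intro extensionalityI[of _ "carrier R"]) (auto simp: Bij_def)
  qed
  ultimately show ?thesis by (simp add: mon_def)
qed

end

section \<open>Verification of the Hartwig conditions\<close>

theorem theorem4p2:
  fixes L :: "('a, 'b) ring_scheme"
    and k \<Gamma> :: "'a set"
    and M :: "('a \<Rightarrow> 'a) set"
    and U :: "(('a \<Rightarrow> 'a) \<Rightarrow> 'a) set"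
  assumes "galois_ring k L \<Gamma> M U"
    and "harish_chandra_subalgebra (skew_emb L M ` k) (skew_emb L M ` \<Gamma>)
           ((skew_monoid_ring L M)\<lparr>carrier := U\<rparr>)"
    and "integrally_closed_domain L \<Gamma>"
  shows "hartwig_conditions k L \<Gamma> (alg_auts (frac_field L \<Gamma>) L) M (integral_closure L \<Gamma>)"
proof -
  have set: "galois_setting k L \<Gamma> M" using assms(1) by (simp add: galois_ring_def)
  interpret field L using set by (simp add: galois_setting_def)
  have \<Gamma>: "subring \<Gamma> L" "noetherian_domain (L\<lparr>carrier := \<Gamma>\<rparr>)" "k \<subseteq> \<Gamma>"
    using set by (auto simp: galois_setting_def)
  have noeth: "noeth \<Gamma>"
    by (rule noeth_of_noetherian_ring[OF \<Gamma>(1) noetherian_domain.axioms(1)[OF \<Gamma>(2)]])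
  have gal: "finite_galois (frac_field L \<Gamma>) L" and char0: "[n] \<cdot>\<^bsub>L\<^esub> \<one>\<^bsub>L\<^esub> \<noteq> \<zero>\<^bsub>L\<^esub>" if "n > 0" for n :: nat
    using set that by (simp_all add: galois_setting_def)
  interpret normal_galois_ext L \<Gamma>
    by (intro normal_galois_ext.intro galois_ext.intro galois_ext_axioms.intro
        normal_galois_ext_axioms.intro field_axioms \<Gamma>(1) noeth gal[OF zero_less_one] char0 assms(3))
  let ?B = "BijGroup (carrier L)" and ?S = "skew_monoid_ring L M"
  note Ls = subringE[OF subring_closure]
  have subM: "submonoid M (alg_aut_group k L)" using set by (simp add: galois_setting_def)
  have M: "M \<subseteq> alg_auts k L" and one: "\<one>\<^bsub>?B\<^esub> \<in> M"
    and Mmult: "\<And>x y. \<lbrakk>x \<in> M; y \<in> M\<rbrakk> \<Longrightarrow> x \<otimes>\<^bsub>?B\<^esub> y \<in> M"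
    using submonoid.subset[OF subM] submonoid.one_closed[OF subM] submonoid.m_closed[OF subM]
    by (auto simp: alg_aut_group_def)
  have kK: "k \<subseteq> K" and kL: "k \<subseteq> \<Lambda>" using \<Gamma>(3) AK A_le_closure by auto
  have kc: "k \<subseteq> carrier L" using kL Ls(1) by auto
  have Gk: "G \<subseteq> alg_auts k L" by (rule alg_auts_antimono[OF kK])
  have conj: "conj_by L g m \<in> M" if "g \<in> G" "m \<in> M" for g m
    using set that by (simp add: galois_setting_def)
  have U: "subring U ?S" "skew_emb L M ` \<Gamma> \<subseteq> U"
    "ideal_prod ?S U (skew_emb L M ` K) = skew_invariants L M G"
    using assms(1) by (auto simp: galois_ring_def Let_def)
  have qc: "quasicentral (skew_emb L M ` \<Gamma>) (?S\<lparr>carrier := U\<rparr>)"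
    using assms(2) by (simp add: harish_chandra_subalgebra_def)
  have inv_mem: "inv\<^bsub>?B\<^esub> \<theta> \<in> alg_auts k L" if "\<theta> \<in> alg_auts k L" for \<theta>
    by (rule subgroup.m_inv_closed[OF alg_auts_subgroup[OF ring_axioms kc] that])
  \<comment> \<open>If \<theta> sends \<Gamma> into \<Lambda>, then it sends \<Lambda> to elements
    integral over \<Lambda>, hence into \<Lambda>. It is applied to \<open>m\<close> and to its
    inverse.\<close>
  have lift: "\<theta> ` \<Lambda> \<subseteq> \<Lambda>" if \<theta>: "\<theta> \<in> alg_auts k L" "\<And>a. a \<in> \<Gamma> \<Longrightarrow> integral_over L \<Gamma> (\<theta> a)" for \<theta>
  proof
    fix y assume "y \<in> \<theta> ` \<Lambda>"
    then obtain x where x: "x \<in> \<Lambda>" "y = \<theta> x" by auto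
    have "\<theta> ` \<Gamma> \<subseteq> \<Lambda>" using \<theta> A_closed(1) alg_autsD(4)[OF \<theta>(1)] by (auto simp: integral_closure_def)
    then have "integral_over L \<Lambda> (\<theta> x)"
      using x by (intro integral_over_hom[OF alg_autsD(2)[OF \<theta>(1)] subring subring_closure])
        (auto simp: integral_closure_def)
    then show "y \<in> \<Lambda>" using integral_over_closure alg_autsD(4)[OF \<theta>(1)] x Ls(1) by auto
  qed
  have Mstab: "M \<subseteq> stab k"
  proof
    fix m assume m: "m \<in> M"
    then have mk: "m \<in> alg_auts k L" using M by auto
    obtain u where "u \<in> U" "u m \<noteq> \<zero>\<^bsub>L\<^esub>"
      using ex_coeff_nonzero[OF M one subgroup_G finite_G Gk conj subringE(1)[OF U(1)] K_closed(1) U(3) m] by auto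
    note int = quasicentral_integral[OF M one subring noeth U(1,2) qc this m]
    show "m \<in> stab k"
      using lift[OF mk int(1)] lift[OF inv_mem[OF mk] int(2)] mk by (simp add: stab_def)
  qed
  have Gstab: "G \<subseteq> stab k"
    using Gk G_closure subgroup.m_inv_closed[OF subgroup_G] by (auto simp: stab_def)
  let ?res = "\<lambda>\<theta>. restrict \<theta> \<Lambda>" and ?Aut = "alg_aut_group k (L\<lparr>carrier := \<Lambda>\<rparr>)"
  have Gmon: "?res \<in> mon ((alg_aut_group k L)\<lparr>carrier := G\<rparr>) ?Aut"
    by (rule restrict_mon[OF kL Gstab subgroup.m_closed[OF subgroup_G]])
  have Mmon: "?res \<in> mon ((alg_aut_group k L)\<lparr>carrier := M\<rparr>) ?Aut"
    by (rule restrict_mon[OF kL Mstab Mmult])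
  have ringL: "ring (L\<lparr>carrier := \<Lambda>\<rparr>)" by (rule subring_is_ring[OF subring_closure])
  have "subgroup (?res ` G) ?Aut"
  proof -
    have "group ((alg_aut_group k L)\<lparr>carrier := G\<rparr>)"
      using subgroup.subgroup_is_group[OF subgroup_G group_BijGroup] by (simp add: alg_aut_group_def)
    then have "group_hom ((alg_aut_group k L)\<lparr>carrier := G\<rparr>) ?Aut ?res"
      using Gmon alg_aut_group[OF ringL, of k] kL by (simp add: group_hom_def group_hom_axioms_def mon_def)
    then show ?thesis using group_hom.img_is_subgroup by force
  qed
  moreover have "submonoid (?res ` M) ?Aut"
  proof
    show "?res ` M \<subseteq> carrier ?Aut"
      using Mmon by (auto simp: mon_def hom_def)
    show "x \<otimes>\<^bsub>?Aut\<^esub> y \<in> ?res ` M" if xy: "x \<in> ?res ` M" "y \<in> ?res ` M" for x y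
    proof -
      obtain p q where pq: "p \<in> M" "q \<in> M" "x = ?res p" "y = ?res q" using xy by auto
      have "?res (p \<otimes>\<^bsub>alg_aut_group k L\<^esub> q) = x \<otimes>\<^bsub>?Aut\<^esub> y"
        using Mmon pq by (auto simp: mon_def hom_def)
      moreover have "p \<otimes>\<^bsub>alg_aut_group k L\<^esub> q \<in> M" by (rule submonoid.m_closed[OF subM pq(1,2)])
      ultimately show ?thesis by (metis imageI)
    qed
    have "?res \<one>\<^bsub>?B\<^esub> = \<one>\<^bsub>?Aut\<^esub>"
      using Ls(1) by (auto simp: BijGroup_simps alg_aut_group_def restrict_def fun_eq_iff)
    then show "\<one>\<^bsub>?Aut\<^esub> \<in> ?res ` M" using one by (metis imageI)
  qed
  moreover have "integrally_closed_domain L \<Lambda>"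
    using subring_is_domain[OF subring_closure] integral_over_closure frac_closure
    by (auto simp: integrally_closed_domain_def)
  \<comment> \<open>An element of \<Lambda> fixed by \<open>G\<close> lies in K, and
    \<open>\<Lambda> \<inter> K\<close> is \<Gamma> by integral closedness.\<close>
  moreover have "\<Gamma> = {x \<in> \<Lambda>. \<forall>g\<in>G. g x = x}"
    using closure_inter_K fixed_field Ls(1) by blast
  moreover have "\<exists>\<tau>\<in>alg_auts k (L\<lparr>carrier := \<Lambda>\<rparr>). is_localization_of L \<Lambda> \<theta> \<tau>"
    if "\<theta> \<in> G \<union> M" for \<theta>
    using that Gstab Mstab restrict_stab[OF kL] stab_localization by blast
  ultimately show ?thesis
    using subring_closure kL noetherian_closure frac_closure Gmon Mmon
    by (simp add: hartwig_conditions_def Let_def)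
qed

end
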